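(* Let $q\ge5$ be a prime power, let $x$ be a point of $\mathbf{W}(q)$ and let $\ell$ be a point on the line at infinity of $\Pi(x)$. Let $\mathbf{B}(\ell)$ be the set of subgroups of $H(\ell)/Z(H(\ell))$ of order $q$ which intersect $B/Z(H(\ell))$ trivially, and let $\mathbf{S}^{\mathbb{S}}(\mathcal{P}(q))$ be the set of Singer groups of $\mathcal{P}(q)$ containing $\mathbb{S}$. Then there is a natural injection $$\eta:\mathbf{B}(\ell)\to\mathbf{S}^{\mathbb{S}}(\mathcal{P}(q)).$$
   Context: $\mathbf{W}(q)$ is the symplectic generalized quadrangle of order $q$ (points of $\mathbf{PG}(3,q)$ and totally isotropic lines of a nondegenerate symplectic polarity). Two points $y,z$ are collinear, written $y\sim z$, if they lie on a common line of $\mathbf{W}(q)$ (with $y\sim y$ allowed); $y^\perp$ is the set of points collinear with $y$, for a set $C$ of points $C^\perp=\bigcap_{c\in C}c^\perp$, and $C^{\perp\perp}=(C^\perp)^\perp$. $\mathbb{S}$ is the group (of order $q$) of all symmetries of $\mathbf{W}(q)$ with center $x$, i.e. automorphisms of $\mathbf{W}(q)$ fixing every point of $x^\perp$. $\mathcal{P}(q)$ is the Payne-derived quadrangle of $\mathbf{W}(q)$ with respect to $x$: its points are the points of $\mathbf{W}(q)$ not collinear with $x$; its lines are the lines of $\mathbf{W}(q)$ not through $x$ together with the sets $\{x,r\}^{\perp\perp}\setminus\{x\}$, $r\not\sim x$; incidence is the natural one. A Singer group of $\mathcal{P}(q)$ is a subgroup of its automorphism group acting sharply transitively on its points. For $q\ge5$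 every automorphism of $\mathcal{P}(q)$ is induced by an automorphism of $\mathbf{W}(q)$ fixing $x$, and $\mathbb{S}$ is identified with the group it induces on $\mathcal{P}(q)$. $\Pi(x)$ is the (Desarguesian) affine plane of order $q$ whose points are the sets $\{x,z\}^\perp$, $z\not\sim x$, and whose lines are the elements of $x^\perp\setminus\{x\}$, with incidence given by containment; $[\infty]$ is its line at infinity. $A$ is the translation group of $\Pi(x)$ (all elations of the projective completion with axis $[\infty]$), $B$ is the dual translation group with respect to $\ell$ (all elations of the projective completion with center $\ell$), and $H(\ell)=\langle A,B\rangle$, a group of order $q^3$ with center $Z(H(\ell))=A\cap B$ of order $q$. *)

theory Defs
  imports "HOL-Analysis.Analysis" "HOL-Algebra.Bij" "HOL-Algebra.Coset"
    "HOL-Algebra.Generated_Groups"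
begin

section \<open>Incidence structures and their automorphisms\<close>

record ('p, 'l) incidence_structure =
  pts :: "'p set"
  lns :: "'l set"
  inc :: "'p \<Rightarrow> 'l \<Rightarrow> bool"

text \<open>Collineations, recorded by their action on points.  In all the geometries below distinct
  lines are incident with distinct sets of points, so the action on lines, which is only required
  to exist here, is determined by the action on points.\<close>

definition automorphisms :: "('p, 'l) incidence_structure \<Rightarrow> ('p \<Rightarrow> 'p) set" where
  "automorphisms D =
     {\<theta> \<in> Bij (pts D). \<exists>\<phi>. bij_betw \<phi> (lns D) (lns D) \<and>
        (\<forall>p\<in>pts D. \<forall>l\<in>lns D. inc D (\<theta> p) (\<phi> l) \<longleftrightarrow> inc D p l)}"

definition aut_group :: "('p, 'l) incidence_structure \<Rightarrow> ('p \<Rightarrow> 'p) monoid" where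
  "aut_group D = (BijGroup (pts D))\<lparr>carrier := automorphisms D\<rparr>"

definition collinear_pts :: "('p, 'l) incidence_structure \<Rightarrow> 'p \<Rightarrow> 'p \<Rightarrow> bool" where
  "collinear_pts D y z \<longleftrightarrow> (\<exists>l\<in>lns D. inc D y l \<and> inc D z l)"

definition perp :: "('p, 'l) incidence_structure \<Rightarrow> 'p set \<Rightarrow> 'p set" where
  "perp D C = {y \<in> pts D. \<forall>c\<in>C. collinear_pts D c y}"

definition singer_groups :: "('p, 'l) incidence_structure \<Rightarrow> ('p \<Rightarrow> 'p) set set" where
  "singer_groups D =
     {G. subgroup G (aut_group D) \<and> (\<forall>p\<in>pts D. \<forall>r\<in>pts D. \<exists>!g. g \<in> G \<and> g p = r)}"


section \<open>The projective completion of an affine plane\<close>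

text \<open>The points at infinity are the parallel classes of lines.\<close>

datatype ('p, 'l) cpoint = Affine_Point 'p | Ideal_Point "'l set"
datatype 'l cline = Affine_Line 'l | Infinity_Line

definition parallel :: "('p, 'l) incidence_structure \<Rightarrow> 'l \<Rightarrow> 'l \<Rightarrow> bool" where
  "parallel D l m \<longleftrightarrow> l = m \<or> (\<nexists>p. p \<in> pts D \<and> inc D p l \<and> inc D p m)"

fun completion_inc ::
  "('p, 'l) incidence_structure \<Rightarrow> ('p, 'l) cpoint \<Rightarrow> 'l cline \<Rightarrow> bool" where
  "completion_inc D (Affine_Point p) (Affine_Line l) \<longleftrightarrow> inc D p l"
| "completion_inc D (Ideal_Point c) (Affine_Line l) \<longleftrightarrow> l \<in> c"
| "completion_inc D (Affine_Point p) Infinity_Line \<longleftrightarrow> False"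
| "completion_inc D (Ideal_Point c) Infinity_Line \<longleftrightarrow> True"

definition completion ::
  "('p, 'l) incidence_structure \<Rightarrow> (('p, 'l) cpoint, 'l cline) incidence_structure" where
  "completion D =
     \<lparr>pts = Affine_Point ` pts D \<union> {Ideal_Point {m \<in> lns D. parallel D l m} | l. l \<in> lns D},
      lns = Affine_Line ` lns D \<union> {Infinity_Line},
      inc = completion_inc D\<rparr>"

text \<open>The elations with center \<open>c\<close> and axis \<open>a\<close>, the identity included.\<close>

definition elations :: "('p, 'l) incidence_structure \<Rightarrow> 'p \<Rightarrow> 'l \<Rightarrow> ('p \<Rightarrow> 'p) set" where
  "elations D c a =
     {\<theta> \<in> automorphisms D. c \<in> pts D \<and> a \<in> lns D \<and> inc D c a \<and>
        (\<forall>p\<in>pts D. inc D p a \<longrightarrow> \<theta> p = p) \<and>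
        (\<forall>m\<in>lns D. inc D c m \<longrightarrow> (\<forall>p\<in>pts D. inc D p m \<longrightarrow> inc D (\<theta> p) m))}"

definition elations_with_axis :: "('p, 'l) incidence_structure \<Rightarrow> 'l \<Rightarrow> ('p \<Rightarrow> 'p) set" where
  "elations_with_axis D a = (\<Union>c. elations D c a)"

definition elations_with_center :: "('p, 'l) incidence_structure \<Rightarrow> 'p \<Rightarrow> ('p \<Rightarrow> 'p) set" where
  "elations_with_center D c = (\<Union>a. elations D c a)"


section \<open>The quadrangles\<close>

text \<open>The vector space \<open>V(4,q)\<close> is \<open>'a^4\<close> for an arbitrary finite field \<open>'a\<close> with \<open>q\<close> elements.
  The symplectic polarities of \<open>PG(3,q)\<close> are those given by the following forms.\<close>

definition symplectic_form :: "('a::field ^ 4 \<Rightarrow> 'a ^ 4 \<Rightarrow> 'a) \<Rightarrow> bool" where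
  "symplectic_form \<beta> \<longleftrightarrow>
     (\<forall>v. Vector_Spaces.linear (*s) (*) (\<beta> v)) \<and>
     (\<forall>w. Vector_Spaces.linear (*s) (*) (\<lambda>v. \<beta> v w)) \<and>
     (\<forall>v. \<beta> v v = 0) \<and>
     (\<forall>v. (\<forall>w. \<beta> v w = 0) \<longrightarrow> v = 0)"

text \<open>Points of \<open>PG(3,q)\<close> are the one-dimensional subspaces of \<open>'a^4\<close>; lines of \<open>W(q)\<close> are
  represented by the sets of points on them.\<close>

type_synonym 'a pg_point = "('a ^ 4) set"
type_synonym 'a pg_set = "('a ^ 4) set set"

definition PG_points :: "'a::field pg_point set" where
  "PG_points = {P. vec.subspace P \<and> vec.dim P = 1}"

definition totally_isotropic :: "('a::field ^ 4 \<Rightarrow> 'a ^ 4 \<Rightarrow> 'a) \<Rightarrow> ('a ^ 4) set \<Rightarrow> bool" where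
  "totally_isotropic \<beta> U \<longleftrightarrow> (\<forall>u\<in>U. \<forall>v\<in>U. \<beta> u v = 0)"

definition W ::
  "('a::field ^ 4 \<Rightarrow> 'a ^ 4 \<Rightarrow> 'a) \<Rightarrow> ('a pg_point, 'a pg_set) incidence_structure" where
  "W \<beta> =
     \<lparr>pts = PG_points,
      lns = {{P \<in> PG_points. P \<subseteq> L} | L.
               vec.subspace L \<and> vec.dim L = 2 \<and> totally_isotropic \<beta> L},
      inc = (\<in>)\<rparr>"

definition payne_derived ::
  "('a::field ^ 4 \<Rightarrow> 'a ^ 4 \<Rightarrow> 'a) \<Rightarrow> 'a pg_point \<Rightarrow> ('a pg_point, 'a pg_set) incidence_structure"
  where
  "payne_derived \<beta> x =
     \<lparr>pts = {z \<in> pts (W \<beta>). \<not> collinear_pts (W \<beta>) x z},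
      lns = {l \<in> lns (W \<beta>). x \<notin> l} \<union>
            {perp (W \<beta>) (perp (W \<beta>) {x, r}) - {x} | r.
               r \<in> pts (W \<beta>) \<and> \<not> collinear_pts (W \<beta>) x r},
      inc = (\<in>)\<rparr>"

definition Pi_plane ::
  "('a::field ^ 4 \<Rightarrow> 'a ^ 4 \<Rightarrow> 'a) \<Rightarrow> 'a pg_point \<Rightarrow> ('a pg_set, 'a pg_point) incidence_structure"
  where
  "Pi_plane \<beta> x =
     \<lparr>pts = {perp (W \<beta>) {x, z} | z. z \<in> pts (W \<beta>) \<and> \<not> collinear_pts (W \<beta>) x z},
      lns = perp (W \<beta>) {x} - {x},
      inc = (\<lambda>p y. y \<in> p)\<rparr>"

abbreviation Pi_completion ::
  "('a::field ^ 4 \<Rightarrow> 'a ^ 4 \<Rightarrow> 'a) \<Rightarrow> 'a pg_point \<Rightarrow>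
     (('a pg_set, 'a pg_point) cpoint, 'a pg_point cline) incidence_structure" where
  "Pi_completion \<beta> x \<equiv> completion (Pi_plane \<beta> x)"


section \<open>Symmetries and Singer groups\<close>

definition symmetries ::
  "('a::field ^ 4 \<Rightarrow> 'a ^ 4 \<Rightarrow> 'a) \<Rightarrow> 'a pg_point \<Rightarrow> ('a pg_point \<Rightarrow> 'a pg_point) set" where
  "symmetries \<beta> x = {\<theta> \<in> automorphisms (W \<beta>). \<forall>y\<in>perp (W \<beta>) {x}. \<theta> y = y}"

definition induced_on_payne ::
  "('a::field ^ 4 \<Rightarrow> 'a ^ 4 \<Rightarrow> 'a) \<Rightarrow> 'a pg_point \<Rightarrow> ('a pg_point \<Rightarrow> 'a pg_point) \<Rightarrow>
     ('a pg_point \<Rightarrow> 'a pg_point)" where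
  "induced_on_payne \<beta> x \<theta> = restrict \<theta> (pts (payne_derived \<beta> x))"

text \<open>The set \<open>S\<^sup>S(P(q))\<close>, with the symmetry group identified with the group it induces.\<close>

definition singer_groups_over_symmetries ::
  "('a::field ^ 4 \<Rightarrow> 'a ^ 4 \<Rightarrow> 'a) \<Rightarrow> 'a pg_point \<Rightarrow> ('a pg_point \<Rightarrow> 'a pg_point) set set" where
  "singer_groups_over_symmetries \<beta> x =
     {G \<in> singer_groups (payne_derived \<beta> x). induced_on_payne \<beta> x ` symmetries \<beta> x \<subseteq> G}"


section \<open>The group \<open>H(\<ell>)\<close> and the set \<open>B(\<ell>)\<close>\<close>

type_synonym 'a cpoint_map =
  "('a pg_set, 'a pg_point) cpoint \<Rightarrow> ('a pg_set, 'a pg_point) cpoint"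

definition translation_group ::
  "('a::field ^ 4 \<Rightarrow> 'a ^ 4 \<Rightarrow> 'a) \<Rightarrow> 'a pg_point \<Rightarrow> 'a cpoint_map set" where
  "translation_group \<beta> x = elations_with_axis (Pi_completion \<beta> x) Infinity_Line"

definition dual_translation_group ::
  "('a::field ^ 4 \<Rightarrow> 'a ^ 4 \<Rightarrow> 'a) \<Rightarrow> 'a pg_point \<Rightarrow>
     ('a pg_set, 'a pg_point) cpoint \<Rightarrow> 'a cpoint_map set" where
  "dual_translation_group \<beta> x l = elations_with_center (Pi_completion \<beta> x) l"

definition H_group ::
  "('a::field ^ 4 \<Rightarrow> 'a ^ 4 \<Rightarrow> 'a) \<Rightarrow> 'a pg_point \<Rightarrow>
     ('a pg_set, 'a pg_point) cpoint \<Rightarrow> 'a cpoint_map monoid" where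
  "H_group \<beta> x l = (aut_group (Pi_completion \<beta> x))
     \<lparr>carrier := generate (aut_group (Pi_completion \<beta> x))
                   (translation_group \<beta> x \<union> dual_translation_group \<beta> x l)\<rparr>"

definition group_center :: "('g, 'm) monoid_scheme \<Rightarrow> 'g set" where
  "group_center G = {z \<in> carrier G. \<forall>g\<in>carrier G. z \<otimes>\<^bsub>G\<^esub> g = g \<otimes>\<^bsub>G\<^esub> z}"

definition H_mod_center ::
  "('a::field ^ 4 \<Rightarrow> 'a ^ 4 \<Rightarrow> 'a) \<Rightarrow> 'a pg_point \<Rightarrow>
     ('a pg_set, 'a pg_point) cpoint \<Rightarrow> 'a cpoint_map set monoid" where
  "H_mod_center \<beta> x l = H_group \<beta> x l Mod group_center (H_group \<beta> x l)"

definition B_mod_center ::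
  "('a::field ^ 4 \<Rightarrow> 'a ^ 4 \<Rightarrow> 'a) \<Rightarrow> 'a pg_point \<Rightarrow>
     ('a pg_set, 'a pg_point) cpoint \<Rightarrow> 'a cpoint_map set set" where
  "B_mod_center \<beta> x l =
     {group_center (H_group \<beta> x l) #>\<^bsub>H_group \<beta> x l\<^esub> b | b. b \<in> dual_translation_group \<beta> x l}"

definition BB ::
  "('a::{field,finite} ^ 4 \<Rightarrow> 'a ^ 4 \<Rightarrow> 'a) \<Rightarrow> 'a pg_point \<Rightarrow>
     ('a pg_set, 'a pg_point) cpoint \<Rightarrow> 'a cpoint_map set set set" where
  "BB \<beta> x l =
     {K. subgroup K (H_mod_center \<beta> x l) \<and> card K = CARD('a) \<and>
         K \<inter> B_mod_center \<beta> x l = {\<one>\<^bsub>H_mod_center \<beta> x l\<^esub>}}"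


section \<open>The natural map\<close>

text \<open>An automorphism of \<open>W(q)\<close> fixing \<open>x\<close> acts on the points of \<open>x\<^sup>\<perp>\<close>, hence on the points and
  lines of \<open>\<Pi>(x)\<close> and on its parallel classes.\<close>

definition induced_on_Pi ::
  "('a::field ^ 4 \<Rightarrow> 'a ^ 4 \<Rightarrow> 'a) \<Rightarrow> 'a pg_point \<Rightarrow> ('a pg_point \<Rightarrow> 'a pg_point) \<Rightarrow>
     'a cpoint_map" where
  "induced_on_Pi \<beta> x \<theta> =
     (\<lambda>P \<in> pts (Pi_completion \<beta> x).
        case P of Affine_Point p \<Rightarrow> Affine_Point (\<theta> ` p) | Ideal_Point c \<Rightarrow> Ideal_Point (\<theta> ` c))"

text \<open>The image of \<open>K\<close> consists of the automorphisms of \<open>P(q)\<close> induced by those automorphisms of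
  \<open>W(q)\<close> fixing \<open>x\<close> whose action on \<open>\<Pi>(x)\<close> lies in the preimage of \<open>K\<close> in \<open>H(\<ell>)\<close>.  As \<open>K\<close> is a
  set of cosets of the center, this preimage is \<open>\<Union>K\<close>.\<close>

definition eta ::
  "('a::field ^ 4 \<Rightarrow> 'a ^ 4 \<Rightarrow> 'a) \<Rightarrow> 'a pg_point \<Rightarrow>
     'a cpoint_map set set \<Rightarrow> ('a pg_point \<Rightarrow> 'a pg_point) set" where
  "eta \<beta> x K =
     induced_on_payne \<beta> x ` {\<theta> \<in> automorphisms (W \<beta>). \<theta> x = x \<and> induced_on_Pi \<beta> x \<theta> \<in> \<Union>K}"

end

theory Submission
  imports Defs
begin

text \<open>In a symplectic frame with \<open>x = \<langle>e\<^sub>0\<rangle>\<close> and \<open>\<ell>\<close> the line \<open>\<langle>e\<^sub>0, e\<^sub>2\<rangle>\<close>, an explicit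
  group of order \<open>q\<^sup>4\<close> of symplectic matrices \<open>T a m k s\<close> acts on \<open>\<Pi>(x)\<close> by
  \<open>(b, c) \<mapsto> (b + a, c + m b + k)\<close>.  Since an elation of a projective plane is determined by its center,
  its axis and the image of one point off the axis, these maps make up \<open>H(\<ell>)\<close>, and a member of
  \<open>\<^bold>B(\<ell>)\<close> is the graph \<open>m = f a\<close> of an additive map.  An automorphism of \<open>W(q)\<close> that fixes every
  point of \<open>x\<^sup>\<perp>\<close> and one further point is the identity, so the preimage of such a
  graph consists of matrices \<open>T a (f a) k s\<close> only.  On the points \<open>\<langle>(z, b, c, 1)\<rangle>\<close> of \<open>P(q)\<close> it is
  sharply transitive: \<open>a\<close> is read off from the second coordinate, then \<open>k\<close> from the third
  and \<open>s\<close> from the first.\<close>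

section \<open>Automorphism groups of incidence structures\<close>

text \<open>The condition on \<open>K\<close> is what sharp transitivity asks for. The pairs (a, m)
  with a = 0 form the image of \<open>B\<close>, and an element with a = 0 and m nonzero has a lift
  with fixed points: \<open>T 0 m 0 0\<close> fixes every point <(z, 0, c, 1)>. A subgroup of order
  q avoiding these pairs picks one m for each a. The resulting f is additive but need not be linear
  over the field.

  The obstacle is that \<open>eta\<close> draws on all automorphisms of W(q), and that A and B
  consist of all elations with the given axis or center; none of them comes with a matrix. In both
  cases an unknown map is divided by an explicit one that agrees with it at a base point, and a
  rigidity statement shows that the quotient is the identity. This avoids describing automorphisms
  as semilinear maps.

  The parameter s is invisible on \<Pi>(x): the maps with a = m = k = 0 are the transvections with
  center x, so the group of order q^4 is an extension of H(\<ell>) by them.\<close>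

lemma automorphismsD:
  assumes "\<theta> \<in> automorphisms D"
  shows "\<theta> \<in> extensional (pts D)" "bij_betw \<theta> (pts D) (pts D)"
  using assms by (auto simp: automorphisms_def Bij_def)

lemma automorphisms_Bij: "automorphisms D \<subseteq> Bij (pts D)"
  by (auto simp: automorphisms_def)

lemma automorphisms_mem:
  assumes "\<theta> \<in> automorphisms D" "p \<in> pts D"
  shows "\<theta> p \<in> pts D"
  using automorphismsD(2)[OF assms(1)] assms(2) by (rule bij_betwE[THEN bspec])

lemma id_automorphism: "(\<lambda>p\<in>pts D. p) \<in> automorphisms D"
  unfolding automorphisms_def
  by (intro CollectI conjI id_Bij exI[of _ id]) simp_all

lemma compose_automorphisms:
  assumes "f \<in> automorphisms D" "g \<in> automorphisms D"
  shows "compose (pts D) f g \<in> automorphisms D"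
proof -
  obtain \<phi> where \<phi>: "bij_betw \<phi> (lns D) (lns D)"
      "\<And>p l. p \<in> pts D \<Longrightarrow> l \<in> lns D \<Longrightarrow> inc D (f p) (\<phi> l) \<longleftrightarrow> inc D p l"
    using assms(1) by (auto simp: automorphisms_def)
  obtain \<psi> where \<psi>: "bij_betw \<psi> (lns D) (lns D)"
      "\<And>p l. p \<in> pts D \<Longrightarrow> l \<in> lns D \<Longrightarrow> inc D (g p) (\<psi> l) \<longleftrightarrow> inc D p l"
    using assms(2) by (auto simp: automorphisms_def)
  have "inc D (compose (pts D) f g p) ((\<phi> \<circ> \<psi>) l) \<longleftrightarrow> inc D p l" if "p \<in> pts D" "l \<in> lns D" for p l
    using that \<phi>(2)[of "g p" "\<psi> l"] \<psi>(2)[of p l] automorphisms_mem[OF assms(2)]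
      bij_betwE[OF \<psi>(1)] by (simp add: compose_def)
  moreover have "compose (pts D) f g \<in> Bij (pts D)"
    using compose_Bij subsetD[OF automorphisms_Bij] assms by blast
  ultimately show ?thesis
    using bij_betw_trans[OF \<psi>(1) \<phi>(1)] unfolding automorphisms_def by blast
qed

lemma inverse_automorphism:
  assumes "f \<in> automorphisms D"
  shows "restrict (inv_into (pts D) f) (pts D) \<in> automorphisms D"
proof -
  obtain \<phi> where \<phi>: "bij_betw \<phi> (lns D) (lns D)"
      "\<And>p l. p \<in> pts D \<Longrightarrow> l \<in> lns D \<Longrightarrow> inc D (f p) (\<phi> l) \<longleftrightarrow> inc D p l"
    using assms by (auto simp: automorphisms_def)
  have "inc D (inv_into (pts D) f p) (inv_into (lns D) \<phi> l) \<longleftrightarrow> inc D p l"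
    if "p \<in> pts D" "l \<in> lns D" for p l
  proof -
    have "f ` pts D = pts D" "\<phi> ` lns D = lns D"
      using automorphismsD(2)[OF assms] \<phi>(1) by (auto simp: bij_betw_def)
    then have "p \<in> f ` pts D" "l \<in> \<phi> ` lns D" using that by simp_all
    then show ?thesis
      using \<phi>(2)[OF inv_into_into inv_into_into, of p f l \<phi>] by (simp add: f_inv_into_f)
  qed
  then have "\<forall>p\<in>pts D. \<forall>l\<in>lns D. inc D (restrict (inv_into (pts D) f) (pts D) p) (inv_into (lns D) \<phi> l)
      \<longleftrightarrow> inc D p l" by simp
  then show ?thesis
    using bij_betw_inv_into[OF \<phi>(1)] restrict_inv_into_Bij[OF subsetD[OF automorphisms_Bij assms]]
    unfolding automorphisms_def by blast
qed

lemma carrier_aut_group [simp]: "carrier (aut_group D) = automorphisms D"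
  by (simp add: aut_group_def)

lemma one_aut_group [simp]: "\<one>\<^bsub>aut_group D\<^esub> = (\<lambda>p\<in>pts D. p)"
  by (simp add: aut_group_def BijGroup_def)

lemma mult_aut_group [simp]:
  "f \<in> automorphisms D \<Longrightarrow> g \<in> automorphisms D \<Longrightarrow> f \<otimes>\<^bsub>aut_group D\<^esub> g = compose (pts D) f g"
  using automorphisms_Bij[of D] by (auto simp: aut_group_def BijGroup_def)

lemma group_aut_group: "group (aut_group D)"
proof (rule groupI)
  fix f assume "f \<in> carrier (aut_group D)"
  then have f: "f \<in> automorphisms D" by simp
  show "\<exists>g\<in>carrier (aut_group D). g \<otimes>\<^bsub>aut_group D\<^esub> f = \<one>\<^bsub>aut_group D\<^esub>"
    using inverse_automorphism[OF f] f Bij_compose_restrict_eq[OF subsetD[OF automorphisms_Bij f]]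
    by (intro bexI[of _ "restrict (inv_into (pts D) f) (pts D)"]) simp_all
next
  fix f g h assume "f \<in> carrier (aut_group D)" "g \<in> carrier (aut_group D)" "h \<in> carrier (aut_group D)"
  then show "f \<otimes>\<^bsub>aut_group D\<^esub> g \<otimes>\<^bsub>aut_group D\<^esub> h = f \<otimes>\<^bsub>aut_group D\<^esub> (g \<otimes>\<^bsub>aut_group D\<^esub> h)"
    by (simp add: compose_automorphisms) (auto simp: compose_def automorphisms_mem restrict_def fun_eq_iff)
next
  fix f assume f: "f \<in> carrier (aut_group D)"
  then show "\<one>\<^bsub>aut_group D\<^esub> \<otimes>\<^bsub>aut_group D\<^esub> f = f"
    using automorphismsD[of f D] 
    by (auto simp: id_automorphism Id_compose bij_betw_imp_funcset)
qed (auto simp: compose_automorphisms id_automorphism)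

lemma automorphism_collinear_iff:
  assumes "\<theta> \<in> automorphisms D" "y \<in> pts D" "z \<in> pts D"
  shows "collinear_pts D (\<theta> y) (\<theta> z) \<longleftrightarrow> collinear_pts D y z"
proof -
  obtain \<phi> where \<phi>: "bij_betw \<phi> (lns D) (lns D)"
      "\<And>p l. p \<in> pts D \<Longrightarrow> l \<in> lns D \<Longrightarrow> inc D (\<theta> p) (\<phi> l) \<longleftrightarrow> inc D p l"
    using assms(1) by (auto simp: automorphisms_def)
  have pre: "\<exists>m\<in>lns D. l = \<phi> m" if "l \<in> lns D" for l
    using \<phi>(1) that unfolding bij_betw_def by (metis imageE)
  have mem: "\<phi> l \<in> lns D" if "l \<in> lns D" for l
    using \<phi>(1) that by (rule bij_betwE[THEN bspec])
  show ?thesis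
  proof
    assume "collinear_pts D (\<theta> y) (\<theta> z)"
    then obtain l where l: "l \<in> lns D" "inc D (\<theta> y) l" "inc D (\<theta> z) l"
      by (auto simp: collinear_pts_def)
    obtain m where "m \<in> lns D" "l = \<phi> m" using pre[OF l(1)] by blast
    then show "collinear_pts D y z" using l \<phi>(2) assms by (auto simp: collinear_pts_def)
  next
    assume "collinear_pts D y z"
    then show "collinear_pts D (\<theta> y) (\<theta> z)" 
      using \<phi>(2) assms mem unfolding collinear_pts_def by blast
  qed
qed

text \<open>Collinearity is preserved in both directions and \<open>\<theta>\<close> is onto. This
  is how automorphisms of W(q) act on the points of \<Pi>(x) and on the new lines of P(q), both of
  which are defined by perps.\<close>

lemma automorphism_perp:
  assumes "\<theta> \<in> automorphisms D" "C \<subseteq> pts D"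
  shows "\<theta> ` perp D C = perp D (\<theta> ` C)"
proof -
  have pre: "\<exists>y\<in>pts D. z = \<theta> y" if "z \<in> pts D" for z
    using automorphismsD(2)[OF assms(1)] that unfolding bij_betw_def by (metis imageE)
  have iff: "\<theta> y \<in> perp D (\<theta> ` C) \<longleftrightarrow> y \<in> perp D C" if y: "y \<in> pts D" for y
  proof -
    have "collinear_pts D (\<theta> c) (\<theta> y) \<longleftrightarrow> collinear_pts D c y" if "c \<in> C" for c
      using automorphism_collinear_iff[OF assms(1) _ y] that assms(2) by blast
    then show ?thesis using y automorphisms_mem[OF assms(1) y] by (simp add: perp_def)
  qed
  have sub: "perp D C \<subseteq> pts D" "perp D (\<theta> ` C) \<subseteq> pts D" by (auto simp: perp_def)
  show ?thesis
  proof
    show "\<theta> ` perp D C \<subseteq> perp D (\<theta> ` C)" using iff sub(1) by auto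
    show "perp D (\<theta> ` C) \<subseteq> \<theta> ` perp D C"
    proof
      fix z assume z: "z \<in> perp D (\<theta> ` C)"
      then obtain y where y: "y \<in> pts D" "z = \<theta> y" using sub(2) pre[of z] by blast
      then show "z \<in> \<theta> ` perp D C" using z iff[OF y(1)] by blast
    qed
  qed
qed

text \<open>The line map in \<open>automorphisms\<close> is only asserted to exist. Where incidence
  is membership and lines consist of points, surjectivity on points forces it to be the image
  map.\<close>

lemma automorphism_line_image:
  assumes "\<theta> \<in> automorphisms D" "l \<in> lns D" "inc D = (\<in>)" "\<And>m. m \<in> lns D \<Longrightarrow> m \<subseteq> pts D"
  shows "\<theta> ` l \<in> lns D"
proof -
  obtain \<phi> where \<phi>: "bij_betw \<phi> (lns D) (lns D)"
      "\<And>p l. p \<in> pts D \<Longrightarrow> l \<in> lns D \<Longrightarrow> inc D (\<theta> p) (\<phi> l) \<longleftrightarrow> inc D p l"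
    using assms(1) by (auto simp: automorphisms_def)
  have pre: "\<exists>y\<in>pts D. z = \<theta> y" if "z \<in> pts D" for z
    using automorphismsD(2)[OF assms(1)] that unfolding bij_betw_def by (metis imageE)
  have \<phi>l: "\<phi> l \<in> lns D" using \<phi>(1) assms(2) by (auto dest: bij_betwE)
  have "\<theta> ` l = \<phi> l"
  proof
    show "\<theta> ` l \<subseteq> \<phi> l" using \<phi>(2) assms by fastforce
    show "\<phi> l \<subseteq> \<theta> ` l"
    proof
      fix r assume r: "r \<in> \<phi> l"
      then obtain p where "p \<in> pts D" "r = \<theta> p" using assms(4)[OF \<phi>l] pre[of r] by blast
      then show "r \<in> \<theta> ` l" using \<phi>(2)[of p l] assms r by auto
    qed
  qed
  with \<phi>l show ?thesis by simp
qed

lemma bij_betw_finite_self: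
  assumes "finite A" "inj_on f A" "f ` A \<subseteq> A"
  shows "bij_betw f A A"
  using endo_inj_surj[OF assms(1,3,2)] assms(2) by (simp add: bij_betw_def)

text \<open>The image map is injective on the finitely many lines, hence permutes them, and serves
  as the required line map.\<close>

lemma automorphismI_image:
  assumes bij: "\<theta> \<in> Bij (pts D)" and "finite (lns D)" and "inc D = (\<in>)"
    and sub: "\<And>l. l \<in> lns D \<Longrightarrow> l \<subseteq> pts D" and im: "\<And>l. l \<in> lns D \<Longrightarrow> \<theta> ` l \<in> lns D"
  shows "\<theta> \<in> automorphisms D"
proof -
  have inj: "inj_on \<theta> (pts D)" using bij by (auto simp: Bij_def bij_betw_def)
  have "inj_on ((`) \<theta>) (lns D)"
    using sub inj by (auto intro!: inj_onI simp: inj_on_image_eq_iff)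
  then have "bij_betw ((`) \<theta>) (lns D) (lns D)"
    using bij_betw_finite_self[OF assms(2)] im by blast
  moreover have "\<theta> p \<in> \<theta> ` l \<longleftrightarrow> p \<in> l" if "p \<in> pts D" "l \<in> lns D" for p l
    using that inj_on_image_mem_iff[OF inj that(1) sub[OF that(2)]] by simp
  ultimately show ?thesis
    using bij assms(3) by (auto simp: automorphisms_def)
qed


section \<open>Projective completions of affine planes\<close>

definition parallel_class :: "('p, 'l) incidence_structure \<Rightarrow> 'l \<Rightarrow> 'l set" where
  "parallel_class D l = {m \<in> lns D. parallel D l m}"

lemma mem_parallel_class [simp]: "m \<in> parallel_class D l \<longleftrightarrow> m \<in> lns D \<and> parallel D l m"
  by (simp add: parallel_class_def)

lemma inc_completion [simp]: "inc (completion D) = completion_inc D"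
  by (simp add: completion_def)

lemma Affine_Point_completion [simp]: "Affine_Point p \<in> pts (completion D) \<longleftrightarrow> p \<in> pts D"
  by (auto simp: completion_def)

lemma Ideal_Point_completion:
  "Ideal_Point c \<in> pts (completion D) \<longleftrightarrow> (\<exists>l\<in>lns D. c = parallel_class D l)"
  by (auto simp: completion_def parallel_class_def)

lemma Affine_Line_completion [simp]: "Affine_Line l \<in> lns (completion D) \<longleftrightarrow> l \<in> lns D"
  by (auto simp: completion_def)

lemma Infinity_Line_completion [simp]: "Infinity_Line \<in> lns (completion D)"
  by (auto simp: completion_def)

text \<open>Parallelism is expressed by incidence, so \<open>g\<close> permutes the parallel
  classes, and the line at infinity is mapped to itself. The map has the shape of
  \<open>induced_on_Pi\<close>, to which it is applied in \<open>h_automorphism\<close>.\<close>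

lemma completion_automorphism:
  assumes f: "bij_betw f (pts D) (pts D)" and g: "bij_betw g (lns D) (lns D)"
    and fg: "\<And>p l. p \<in> pts D \<Longrightarrow> l \<in> lns D \<Longrightarrow> inc D (f p) (g l) \<longleftrightarrow> inc D p l"
  shows "(\<lambda>P \<in> pts (completion D). case P of Affine_Point p \<Rightarrow> Affine_Point (f p)
            | Ideal_Point c \<Rightarrow> Ideal_Point (g ` c)) \<in> automorphisms (completion D)"
    (is "?F \<in> _")
proof -
  let ?G = "\<lambda>L. case L of Affine_Line l \<Rightarrow> Affine_Line (g l) | Infinity_Line \<Rightarrow> Infinity_Line"
  have fD: "f p \<in> pts D" if "p \<in> pts D" for p using f that by (rule bij_betwE[THEN bspec])
  have gD: "g l \<in> lns D" if "l \<in> lns D" for l using g that by (rule bij_betwE[THEN bspec])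
  have fpre: "\<exists>r\<in>pts D. p = f r" if "p \<in> pts D" for p
    using f that unfolding bij_betw_def by (metis imageE)
  have gpre: "\<exists>m\<in>lns D. l = g m" if "l \<in> lns D" for l
    using g that unfolding bij_betw_def by (metis imageE)
  have finj: "inj_on f (pts D)" and ginj: "inj_on g (lns D)"
    using f g by (auto simp: bij_betw_def)
  have par: "parallel D (g l) (g m) \<longleftrightarrow> parallel D l m" if lm: "l \<in> lns D" "m \<in> lns D" for l m
  proof -
    have "(\<exists>p\<in>pts D. inc D p (g l) \<and> inc D p (g m)) \<longleftrightarrow> (\<exists>p\<in>pts D. inc D p l \<and> inc D p m)"
    proof
      assume "\<exists>p\<in>pts D. inc D p (g l) \<and> inc D p (g m)"
      then obtain r where r: "r \<in> pts D" "inc D r (g l)" "inc D r (g m)" by blast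
      obtain p where "p \<in> pts D" "r = f p" using fpre[OF r(1)] by blast
      then show "\<exists>p\<in>pts D. inc D p l \<and> inc D p m" using fg lm r by blast
    next
      assume "\<exists>p\<in>pts D. inc D p l \<and> inc D p m"
      then show "\<exists>p\<in>pts D. inc D p (g l) \<and> inc D p (g m)" using fg lm fD by blast
    qed
    moreover have "g l = g m \<longleftrightarrow> l = m"
      using ginj lm by (rule inj_on_eq_iff)
    ultimately show ?thesis unfolding parallel_def by blast
  qed
  have cls: "g ` parallel_class D l = parallel_class D (g l)" if l: "l \<in> lns D" for l
  proof
    show "g ` parallel_class D l \<subseteq> parallel_class D (g l)" using par[OF l] gD by auto
    show "parallel_class D (g l) \<subseteq> g ` parallel_class D l"
    proof
      fix n assume n: "n \<in> parallel_class D (g l)"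
      then obtain m where "m \<in> lns D" "n = g m" using gpre[of n] by auto
      then show "n \<in> g ` parallel_class D l" using n par[OF l] by auto
    qed
  qed
  have F: "?F (Affine_Point p) = Affine_Point (f p)" if "p \<in> pts D" for p
    using that by simp
  have F': "?F (Ideal_Point (parallel_class D l)) = Ideal_Point (parallel_class D (g l))" if "l \<in> lns D" for l
    using that by (auto simp: Ideal_Point_completion cls)
  have mem: "?F P \<in> pts (completion D)" if P: "P \<in> pts (completion D)" for P
  proof (cases P)
    case (Affine_Point p)
    then show ?thesis using F[of p] fD P by simp
  next
    case (Ideal_Point c)
    then obtain l where "l \<in> lns D" "P = Ideal_Point (parallel_class D l)"
      using P by (auto simp: Ideal_Point_completion)
    then show ?thesis using F' gD by (auto simp: Ideal_Point_completion)
  qed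
  have pre: "P \<in> ?F ` pts (completion D)" if P: "P \<in> pts (completion D)" for P
  proof (cases P)
    case (Affine_Point p)
    then obtain r where r: "r \<in> pts D" "p = f r" using P fpre by auto
    show ?thesis unfolding Affine_Point r(2) F[OF r(1), symmetric]
      by (rule imageI) (simp add: r(1))
  next
    case (Ideal_Point c)
    then obtain l where "l \<in> lns D" "c = parallel_class D l"
      using P by (auto simp: Ideal_Point_completion)
    then obtain m where m: "m \<in> lns D" "c = parallel_class D (g m)" using gpre by blast
    show ?thesis unfolding Ideal_Point m(2) F'[OF m(1), symmetric]
      by (rule imageI) (use m(1) in \<open>auto simp: Ideal_Point_completion\<close>)
  qed
  have "inj_on ?F (pts (completion D))"
  proof (rule inj_onI)
    fix P Q assume P: "P \<in> pts (completion D)" and Q: "Q \<in> pts (completion D)" and eq: "?F P = ?F Q"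
    show "P = Q"
    proof (cases P)
      case (Affine_Point p)
      then obtain r where "Q = Affine_Point r" using eq P Q by (cases Q) auto
      with Affine_Point eq P Q show ?thesis
        by (simp add: inj_on_eq_iff[OF finj])
    next
      case (Ideal_Point c)
      then obtain d where d: "Q = Ideal_Point d" using eq P Q by (cases Q) auto
      have "c \<subseteq> lns D" "d \<subseteq> lns D"
        using P Q Ideal_Point d by (auto simp: Ideal_Point_completion)
      moreover have "g ` c = g ` d" using eq P Q Ideal_Point d by simp
      ultimately show ?thesis
        using Ideal_Point d inj_on_image_eq_iff[OF ginj] by simp
    qed
  qed
  then have "?F \<in> Bij (pts (completion D))"
    using mem pre unfolding Bij_def bij_betw_def by (intro IntI CollectI conjI restrict_extensional) blast+
  moreover have "bij_betw ?G (lns (completion D)) (lns (completion D))"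
  proof (rule bij_betw_imageI)
    show "inj_on ?G (lns (completion D))"
      using ginj by (auto intro!: inj_onI split: cline.splits dest: inj_onD)
    show "?G ` lns (completion D) = lns (completion D)"
    proof
      show "?G ` lns (completion D) \<subseteq> lns (completion D)"
        using gD by (auto split: cline.splits)
      show "lns (completion D) \<subseteq> ?G ` lns (completion D)"
      proof
        fix L assume L: "L \<in> lns (completion D)"
        show "L \<in> ?G ` lns (completion D)"
        proof (cases L)
          case (Affine_Line l)
          then obtain m where "m \<in> lns D" "l = g m" using L gpre by auto
          then show ?thesis using Affine_Line by (intro image_eqI[of _ _ "Affine_Line m"]) auto
        next
          case Infinity_Line
          then show ?thesis by (intro image_eqI[of _ _ Infinity_Line]) auto
        qed
      qed
    qed
  qed
  moreover have "inc (completion D) (?F P) (?G L) \<longleftrightarrow> inc (completion D) P L"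
    if P: "P \<in> pts (completion D)" and L: "L \<in> lns (completion D)" for P L
  proof (cases P)
    case (Affine_Point p)
    then have p: "p \<in> pts D" using P by simp
    show ?thesis unfolding Affine_Point F[OF p] using L
      by (cases L) (auto simp: fg[OF p])
  next
    case (Ideal_Point c)
    then obtain l where l: "l \<in> lns D" "P = Ideal_Point (parallel_class D l)"
      using P by (auto simp: Ideal_Point_completion)
    show ?thesis unfolding l(2) F'[OF l(1)] using L gD
      by (cases L) (auto simp: par[OF l(1)])
  qed
  ultimately show ?thesis unfolding automorphisms_def by blast
qed

text \<open>Axioms from which the completion inherits joins, meets and uniqueness of joins, the
  hypotheses of \<open>elation_eq_id\<close>. Transitivity of parallelism is an axiom because in
  coordinates it is just proportionality of directions.\<close>

locale affine_plane_incidence =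
  fixes D :: "('p, 'l) incidence_structure"
  assumes line_through: "\<lbrakk>p \<in> pts D; r \<in> pts D\<rbrakk> \<Longrightarrow> \<exists>l\<in>lns D. inc D p l \<and> inc D r l"
    and line_unique: "\<lbrakk>p \<in> pts D; r \<in> pts D; p \<noteq> r; l \<in> lns D; m \<in> lns D;
      inc D p l; inc D r l; inc D p m; inc D r m\<rbrakk> \<Longrightarrow> l = m"
    and parallel_through: "\<lbrakk>p \<in> pts D; l \<in> lns D\<rbrakk> \<Longrightarrow> \<exists>m\<in>lns D. inc D p m \<and> parallel D l m"
    and parallel_trans: "\<lbrakk>k \<in> lns D; l \<in> lns D; m \<in> lns D; parallel D k l; parallel D k m\<rbrakk> \<Longrightarrow> parallel D l m"
    and nonempty: "lns D \<noteq> {}"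
begin

lemma parallel_sym: "parallel D l m \<Longrightarrow> parallel D m l"
  by (auto simp: parallel_def)

lemma parallel_class_eq:
  assumes "k \<in> lns D" "l \<in> lns D" "parallel D k l"
  shows "parallel_class D k = parallel_class D l"
proof (rule Set.set_eqI)
  fix m show "m \<in> parallel_class D k \<longleftrightarrow> m \<in> parallel_class D l"
    using assms parallel_trans[of k l m] parallel_trans[of l k m] parallel_sym[of k l] by auto
qed

lemma completion_line_through:
  assumes P: "P \<in> pts (completion D)" and R: "R \<in> pts (completion D)"
  shows "\<exists>L\<in>lns (completion D). completion_inc D P L \<and> completion_inc D R L"
proof -
  have mixed: "\<exists>L\<in>lns (completion D). completion_inc D (Affine_Point p) L \<and> completion_inc D (Ideal_Point c) L"
    if p: "p \<in> pts D" and c: "Ideal_Point c \<in> pts (completion D)" for p c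
  proof -
    obtain l where l: "l \<in> lns D" "c = parallel_class D l"
      using c by (auto simp: Ideal_Point_completion)
    obtain m where "m \<in> lns D" "inc D p m" "parallel D l m"
      using parallel_through[OF p l(1)] by blast
    then show ?thesis using l by (intro bexI[of _ "Affine_Line m"]) auto
  qed
  show ?thesis
  proof (cases P)
    case p: (Affine_Point p)
    show ?thesis
    proof (cases R)
      case (Affine_Point r)
      then obtain l where "l \<in> lns D" "inc D p l" "inc D r l" using p P R line_through[of p r] by auto
      then show ?thesis using p Affine_Point by (intro bexI[of _ "Affine_Line l"]) auto
    next
      case (Ideal_Point c)
      then show ?thesis using mixed[of p c] p P R by auto
    qed
  next
    case c: (Ideal_Point c)
    show ?thesis
    proof (cases R)
      case (Affine_Point r)
      then show ?thesis using mixed[of r c] c P R by auto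
    next
      case (Ideal_Point d)
      then show ?thesis using c by (intro bexI[of _ "Infinity_Line"]) auto
    qed
  qed
qed

text \<open>Besides uniqueness in the affine plane, two facts enter: distinct parallel classes are
  disjoint, and parallel lines through a common affine point coincide.\<close>

lemma completion_line_unique:
  assumes P: "P \<in> pts (completion D)" and R: "R \<in> pts (completion D)" and PR: "P \<noteq> R"
    and L: "L \<in> lns (completion D)" and M: "M \<in> lns (completion D)"
    and i: "completion_inc D P L" "completion_inc D R L" "completion_inc D P M" "completion_inc D R M"
  shows "L = M"
proof -
  have ideal: False if c: "Ideal_Point c \<in> pts (completion D)" and d: "Ideal_Point d \<in> pts (completion D)"
    and "c \<noteq> d" "l \<in> c" "l \<in> d" for c d l
  proof -
    obtain j where j: "j \<in> lns D" "c = parallel_class D j"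
      using c by (auto simp: Ideal_Point_completion)
    obtain k where k: "k \<in> lns D" "d = parallel_class D k"
      using d by (auto simp: Ideal_Point_completion)
    show False using that j k parallel_class_eq[of j l] parallel_class_eq[of k l] by simp
  qed
  have mixed: "l = m" if p: "p \<in> pts D" and c: "Ideal_Point c \<in> pts (completion D)"
    and lm: "l \<in> c" "m \<in> c" "inc D p l" "inc D p m" for p c l m
  proof -
    obtain k where k: "k \<in> lns D" "c = parallel_class D k"
      using c by (auto simp: Ideal_Point_completion)
    have "parallel D l m" using lm k parallel_trans[of k l m] by simp
    then show ?thesis using p lm unfolding parallel_def by blast
  qed
  show ?thesis
  proof (cases L)
    case l: (Affine_Line l)
    show ?thesis
    proof (cases M)
      case m: (Affine_Line m)
      have "l = m"
      proof (cases P)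
        case p: (Affine_Point p)
        show ?thesis
        proof (cases R)
          case (Affine_Point r)
          then show ?thesis using P R PR L M i p l m line_unique[of p r l m] by simp
        next
          case (Ideal_Point d)
          then show ?thesis using P R i p l m mixed[of p d l m] by simp
        qed
      next
        case c: (Ideal_Point c)
        show ?thesis
        proof (cases R)
          case (Affine_Point r)
          then show ?thesis using P R i c l m mixed[of r c l m] by simp
        next
          case (Ideal_Point d)
          then show ?thesis using P R PR i c l ideal[of c d l] by simp
        qed
      qed
      then show ?thesis using l m by simp
    next
      case Infinity_Line
      then show ?thesis using P R PR i l ideal by (cases P; cases R) auto
    qed
  next
    case inf: Infinity_Line
    then show ?thesis using P R PR i ideal by (cases M; cases P; cases R) auto
  qed
qed

lemma completion_meet:
  assumes L: "L \<in> lns (completion D)" and M: "M \<in> lns (completion D)"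
  shows "\<exists>P\<in>pts (completion D). completion_inc D P L \<and> completion_inc D P M"
proof -
  have ideal: "Ideal_Point (parallel_class D l) \<in> pts (completion D)" "l \<in> parallel_class D l" if "l \<in> lns D" for l
    using that by (auto simp: Ideal_Point_completion parallel_def)
  have aff: "\<exists>P\<in>pts (completion D). completion_inc D P (Affine_Line l) \<and> completion_inc D P (Affine_Line m)"
    if lm: "l \<in> lns D" "m \<in> lns D" for l m
  proof (cases "parallel D l m")
    case True
    then show ?thesis using ideal[OF lm(1)] lm(2)
      by (intro bexI[of _ "Ideal_Point (parallel_class D l)"]) auto
  next
    case False
    then obtain p where "p \<in> pts D" "inc D p l" "inc D p m" by (auto simp: parallel_def)
    then show ?thesis by (intro bexI[of _ "Affine_Point p"]) auto
  qed
  have inf: "\<exists>P\<in>pts (completion D). completion_inc D P (Affine_Line l) \<and> completion_inc D P Infinity_Line"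
    if l: "l \<in> lns D" for l
    using ideal[OF l] by (intro bexI[of _ "Ideal_Point (parallel_class D l)"]) auto
  show ?thesis
  proof (cases L)
    case l: (Affine_Line l)
    then show ?thesis using L M aff[of l] inf[of l] by (cases M) auto
  next
    case l: Infinity_Line
    \<comment> \<open>Supplies a point at infinity for the case where both lines are the line at
      infinity.\<close>
    obtain k where "k \<in> lns D" using nonempty by blast
    then show ?thesis using l L M inf[of k] inf by (cases M) (simp_all, blast+)
  qed
qed

end

text \<open>Lets an unknown elation be divided by an explicit one with the same center and axis,
  leaving an elation with an additional fixed point.\<close>

lemma compose_elations:
  assumes "f \<in> elations D c a" "g \<in> elations D c a"
  shows "compose (pts D) f g \<in> elations D c a"
  using assms compose_automorphisms[of f D g] automorphisms_mem[of g D]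
  by (auto simp: elations_def compose_def)

text \<open>For \<open>p\<close> off the axis and off \<open>m = Qc\<close>, the lines \<open>Qp\<close> and \<open>cp\<close> are both fixed, hence so is
  \<open>p\<close>.  The second fixed point \<open>Q'\<close> obtained in this way takes care of the points of \<open>m\<close>.\<close>

lemma elation_eq_id:
  assumes join: "\<And>p r. p \<in> pts D \<Longrightarrow> r \<in> pts D \<Longrightarrow> \<exists>m\<in>lns D. inc D p m \<and> inc D r m"
    and meet: "\<And>m n. m \<in> lns D \<Longrightarrow> n \<in> lns D \<Longrightarrow> \<exists>p\<in>pts D. inc D p m \<and> inc D p n"
    and uniq: "\<And>p r m n. \<lbrakk>p \<in> pts D; r \<in> pts D; p \<noteq> r; m \<in> lns D; n \<in> lns D;
      inc D p m; inc D r m; inc D p n; inc D r n\<rbrakk> \<Longrightarrow> m = n"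
    and \<theta>: "\<theta> \<in> elations D c a"
    and Q: "Q \<in> pts D" "\<not> inc D Q a" "\<theta> Q = Q"
    and m: "m \<in> lns D" "inc D c m" "inc D Q m"
    and Q': "Q' \<in> pts D" "\<not> inc D Q' a" "\<not> inc D Q' m"
  shows "\<theta> = (\<lambda>p\<in>pts D. p)"
proof -
  have aut: "\<theta> \<in> automorphisms D" and ca: "c \<in> pts D" "a \<in> lns D" "inc D c a"
    and axis: "\<And>p. p \<in> pts D \<Longrightarrow> inc D p a \<Longrightarrow> \<theta> p = p"
    and center: "\<And>k p. \<lbrakk>k \<in> lns D; inc D c k; p \<in> pts D; inc D p k\<rbrakk> \<Longrightarrow> inc D (\<theta> p) k"
    using \<theta> by (auto simp: elations_def)
  obtain \<phi> where \<phi>: "bij_betw \<phi> (lns D) (lns D)"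
      "\<And>p l. p \<in> pts D \<Longrightarrow> l \<in> lns D \<Longrightarrow> inc D (\<theta> p) (\<phi> l) \<longleftrightarrow> inc D p l"
    using aut by (auto simp: automorphisms_def)
  have step: "\<theta> r = r"
    if r: "r \<in> pts D" "\<not> inc D r m" "\<not> inc D r a"
      and Q: "Q \<in> pts D" "\<not> inc D Q a" "\<theta> Q = Q" and m: "m \<in> lns D" "inc D c m" "inc D Q m" for r Q m
  proof -
    obtain n where n: "n \<in> lns D" "inc D Q n" "inc D r n" using join[OF Q(1) r(1)] by blast
    obtain s where s: "s \<in> pts D" "inc D s n" "inc D s a" using meet[OF n(1) ca(2)] by blast
    have "\<phi> n \<in> lns D" using \<phi>(1) n(1) by (auto dest: bij_betwE)
    moreover have "inc D Q (\<phi> n)" "inc D s (\<phi> n)"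
      using \<phi>(2)[OF Q(1) n(1)] \<phi>(2)[OF s(1) n(1)] Q n s axis by auto
    moreover have "s \<noteq> Q" using s Q by auto
    ultimately have "\<phi> n = n" using uniq Q n s by metis
    then have 1: "inc D (\<theta> r) n" using \<phi>(2)[OF r(1) n(1)] n by simp
    obtain k where k: "k \<in> lns D" "inc D c k" "inc D r k" using join[OF ca(1) r(1)] by blast
    have 2: "inc D (\<theta> r) k" using center k r by blast
    have "n \<noteq> k"
    proof
      assume "n = k"
      then have "n = m" using uniq[OF ca(1) Q(1)] ca Q k n m by blast
      then show False using n r by simp
    qed
    then show ?thesis
      using uniq[OF automorphisms_mem[OF aut r(1)] r(1)] 1 2 n k by blast
  qed
  have Q'fix: "\<theta> Q' = Q'" using step[OF Q'(1,3,2) Q m] .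
  obtain m' where m': "m' \<in> lns D" "inc D c m'" "inc D Q' m'" using join[OF ca(1) Q'(1)] by blast
  have "\<theta> p = p" if p: "p \<in> pts D" for p
  proof (cases "inc D p a")
    case True
    then show ?thesis using axis p by blast
  next
    case False
    show ?thesis
    proof (cases "inc D p m")
      case True
      have "p \<noteq> c" using ca False by auto
      then have "\<not> inc D p m'" using uniq[OF p ca(1) _ m'(1) m(1)] True m m' Q' by blast
      then show ?thesis using step[OF p _ False Q'(1,2) Q'fix m'] by blast
    next
      case False
      then show ?thesis using step[OF p _ \<open>\<not> inc D p a\<close> Q m] by blast
    qed
  qed
  then show ?thesis
    using automorphismsD(1)[OF aut] by (auto simp: extensional_def fun_eq_iff)
qed

section \<open>The symplectic quadrangle in coordinates\<close>

definition proj :: "'a::field ^ 4 \<Rightarrow> 'a pg_point" where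
  "proj v = range (\<lambda>t. t *s v)"

lemma proj_span: "proj v = vec.span {v}"
  by (simp add: proj_def vec.span_singleton)

lemma subspace_proj: "vec.subspace (proj v)"
  by (simp add: proj_span)

lemma self_in_proj: "v \<in> proj v"
  by (simp add: proj_span vec.span_base)

lemma proj_subset_iff:
  assumes "vec.subspace L"
  shows "proj v \<subseteq> L \<longleftrightarrow> v \<in> L"
  using assms self_in_proj[of v] vec.span_minimal[of "{v}" L] unfolding proj_span by auto

lemma PG_points_eq: "PG_points = proj ` {v. v \<noteq> 0}"
proof
  show "proj ` {v. v \<noteq> 0} \<subseteq> PG_points"
    by (auto simp: PG_points_def subspace_proj) (simp add: proj_span)
  show "PG_points \<subseteq> proj ` {v::'a^4. v \<noteq> 0}"
  proof
    fix P :: "'a pg_point" assume "P \<in> PG_points"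
    then have P: "vec.subspace P" "vec.dim P = 1" by (auto simp: PG_points_def)
    obtain B where B: "B \<subseteq> P" "vec.independent B" "P \<subseteq> vec.span B" "card B = 1"
      using vec.basis_exists[of P] P(2) by metis
    then obtain b where b: "B = {b}" using card_1_singletonE by blast
    have "b \<noteq> 0" using B(2) b vec.dependent_zero by blast
    moreover have "P = proj b"
      using B b vec.span_minimal[OF B(1) P(1)] by (auto simp: proj_span)
    ultimately show "P \<in> proj ` {v. v \<noteq> 0}" by blast
  qed
qed

lemma proj_eq_iff:
  assumes "u \<noteq> 0"
  shows "proj u = proj v \<longleftrightarrow> (\<exists>t. t \<noteq> 0 \<and> v = t *s u)"
proof
  assume "proj u = proj v"
  then have "u \<in> proj v" "v \<in> proj u" using self_in_proj by metis+
  then obtain s t where st: "u = s *s v" "v = t *s u" unfolding proj_def by (elim rangeE)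
  then have "t \<noteq> 0" using assms by auto
  then show "\<exists>t. t \<noteq> 0 \<and> v = t *s u" using st by blast
next
  assume "\<exists>t. t \<noteq> 0 \<and> v = t *s u"
  then obtain t where t: "t \<noteq> 0" "v = t *s u" by blast
  then have "u = (1 / t) *s v" by simp
  then have "u \<in> proj v" "v \<in> proj u" using t(2) unfolding proj_def by (metis rangeI)+
  then show "proj u = proj v"
    using proj_subset_iff[OF subspace_proj] by blast
qed

locale symplectic_space =
  fixes \<beta> :: "'a::{field,finite} ^ 4 \<Rightarrow> 'a ^ 4 \<Rightarrow> 'a"
  assumes symplectic: "symplectic_form \<beta>"
begin

lemma form_linear:
  "\<beta> (u + v) w = \<beta> u w + \<beta> v w" "\<beta> w (u + v) = \<beta> w u + \<beta> w v"
  "\<beta> (t *s v) w = t * \<beta> v w" "\<beta> w (t *s v) = t * \<beta> w v"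
proof -
  have l: "Vector_Spaces.linear (*s) (*) (\<beta> v)" "Vector_Spaces.linear (*s) (*) (\<lambda>v. \<beta> v w)" for v w
    using symplectic by (auto simp: symplectic_form_def)
  have "module_hom (*s) (*) (\<beta> v)" "module_hom (*s) (*) (\<lambda>v. \<beta> v w)" for v w
    using l unfolding Vector_Spaces.linear_def by blast+
  note m = this
  show "\<beta> (u + v) w = \<beta> u w + \<beta> v w" "\<beta> w (u + v) = \<beta> w u + \<beta> w v"
    "\<beta> (t *s v) w = t * \<beta> v w" "\<beta> w (t *s v) = t * \<beta> w v"
    using module_hom.add[OF m(1)] module_hom.add[OF m(2)] module_hom.scale[OF m(1)]
      module_hom.scale[OF m(2)] by auto
qed

lemma form_self [simp]: "\<beta> v v = 0"
  using symplectic by (simp add: symplectic_form_def)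

lemma form_nondegenerate: "(\<And>w. \<beta> v w = 0) \<Longrightarrow> v = 0"
  using symplectic by (simp add: symplectic_form_def)

lemma form_skew: "\<beta> v u = - \<beta> u v"
proof -
  have "\<beta> (u + v) (u + v) = \<beta> v u + \<beta> u v" by (simp only: form_linear(1,2)) simp
  then have "\<beta> v u + \<beta> u v = 0" by (simp only: form_self)
  then show ?thesis by (simp only: eq_neg_iff_add_eq_0)
qed

lemma form_zero [simp]: "\<beta> 0 v = 0" "\<beta> v 0 = 0"
  using form_linear(3)[of 0 0 v] form_linear(4)[of v 0 0] by simp_all

lemma form_diff:
  "\<beta> (u - v) w = \<beta> u w - \<beta> v w" "\<beta> w (u - v) = \<beta> w u - \<beta> w v"
  using form_linear(1)[of "u - v" v w] form_linear(2)[of w "u - v" v] by simp_all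

lemma span_pair: "x \<in> vec.span {u, v} \<longleftrightarrow> (\<exists>a b. x = a *s u + b *s v)"
proof
  assume "x \<in> vec.span {u, v}"
  then obtain a b where "x - a *s u = b *s v"
    by (auto simp: vec.span_breakdown_eq[of x u "{v}"] vec.span_singleton)
  then have "x = a *s u + b *s v" by (simp add: algebra_simps)
  then show "\<exists>a b. x = a *s u + b *s v" by blast
next
  assume "\<exists>a b. x = a *s u + b *s v"
  then show "x \<in> vec.span {u, v}"
    using vec.span_add[OF vec.span_scale vec.span_scale, OF vec.span_base vec.span_base, of u "{u, v}" v]
    by auto
qed

lemma span_pair_line:
  assumes "u \<noteq> 0" "v \<notin> proj u" "\<beta> u v = 0"
  shows "{P \<in> PG_points. P \<subseteq> vec.span {u, v}} \<in> lns (W \<beta>)"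
proof -
  have "vec.independent {v, u}"
    using assms by (auto simp: vec.independent_insert proj_span)
  moreover have "v \<noteq> u" using assms(2) self_in_proj by blast
  ultimately have "vec.dim (vec.span {u, v}) = 2"
    using vec.dim_span_eq_card_independent[of "{v, u}"] by (simp add: insert_commute)
  moreover have "totally_isotropic \<beta> (vec.span {u, v})"
    unfolding totally_isotropic_def
    using assms(3) form_skew[of v u] by (auto simp: span_pair form_linear)
  ultimately show ?thesis
    unfolding W_def using vec.subspace_span by auto
qed

lemma ex_form_one:
  assumes "u \<noteq> 0"
  shows "\<exists>v. \<beta> u v = 1"
proof -
  obtain v where "\<beta> u v \<noteq> 0" using form_nondegenerate assms by blast
  then have "\<beta> u ((1 / \<beta> u v) *s v) = 1" by (simp add: form_linear)
  then show ?thesis by blast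
qed

lemma pts_W [simp]: "pts (W \<beta>) = PG_points"
  by (simp add: W_def)

lemma inc_W [simp]: "inc (W \<beta>) = (\<in>)"
  by (simp add: W_def)

lemma proj_PG [simp]: "proj v \<in> PG_points \<longleftrightarrow> v \<noteq> 0"
proof
  assume "proj v \<in> PG_points"
  then show "v \<noteq> 0" by (auto simp: PG_points_def proj_span vec.dim_insert)
qed (auto simp: PG_points_eq)

lemma collinear_proj_iff:
  assumes "u \<noteq> 0" "v \<noteq> 0"
  shows "collinear_pts (W \<beta>) (proj u) (proj v) \<longleftrightarrow> \<beta> u v = 0"
proof
  assume "collinear_pts (W \<beta>) (proj u) (proj v)"
  then obtain L where "vec.subspace L" "totally_isotropic \<beta> L" "proj u \<subseteq> L" "proj v \<subseteq> L"
    by (auto simp: collinear_pts_def W_def)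
  then show "\<beta> u v = 0" using self_in_proj unfolding totally_isotropic_def by blast
next
  assume uv: "\<beta> u v = 0"
  have line: "collinear_pts (W \<beta>) (proj u) (proj v)"
    if "w \<notin> proj u" "\<beta> u w = 0" "v \<in> vec.span {u, w}" for w
    using span_pair_line[OF assms(1) that(1,2)] that(3) assms vec.span_base[of u "{u, w}"]
    unfolding collinear_pts_def
    by (intro bexI[of _ "{P \<in> PG_points. P \<subseteq> vec.span {u, w}}"]) (simp_all add: proj_subset_iff PG_points_eq)
  show "collinear_pts (W \<beta>) (proj u) (proj v)"
  proof (cases "v \<in> proj u")
    case False
    then show ?thesis using line[of v] uv vec.span_base[of v "{u, v}"] by simp
  next
    case True
    \<comment> \<open>The two points coincide, so any totally isotropic line through
      \<open>u\<close> will do. A vector \<open>y\<close> outside the span of \<open>u\<close> and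
      \<open>z\<close>, made orthogonal to \<open>u\<close> by subtracting a multiple of
      \<open>z\<close>, spans such a line together with \<open>u\<close>.\<close>
    obtain z where z: "\<beta> u z = 1" using ex_form_one assms(1) by blast
    have "vec.span {u, z} \<noteq> UNIV"
    proof
      assume "vec.span {u, z} = UNIV"
      then have "vec.dim (UNIV :: ('a^4) set) \<le> card {u, z}"
        by (intro vec.dim_le_card) auto
      also have "\<dots> \<le> 2" by (simp add: card_insert_if)
      finally show False using vec_dim_card[where 'a='a and 'n=4] by simp
    qed
    then obtain y where y: "y \<notin> vec.span {u, z}" by blast
    define w where "w = y - \<beta> u y *s z"
    have "\<beta> u w = 0" by (simp add: w_def form_diff form_linear z)
    moreover have "w \<notin> proj u"
    proof
      assume "w \<in> proj u"
      then obtain t where "w = t *s u" by (auto simp: proj_def)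
      then have "y = t *s u + \<beta> u y *s z" by (simp add: w_def algebra_simps)
      then show False using y span_pair by blast
    qed
    moreover have "v \<in> vec.span {u, w}"
      using True vec.span_mono[of "{u}" "{u, w}"] by (auto simp: proj_span)
    ultimately show ?thesis using line by blast
  qed
qed

end

text \<open>For \<open>x = \<langle>e\<^sub>0\<rangle>\<close> the points of \<open>\<Pi>(x)\<close> become the pairs \<open>(b, c)\<close>, its lines the triples
  \<open>(w\<^sub>0, w\<^sub>1, w\<^sub>2)\<close> up to scalars with \<open>(w\<^sub>1, w\<^sub>2) \<noteq> 0\<close>, and incidence the
  equation \<open>w\<^sub>0 = b w\<^sub>2 - c w\<^sub>1\<close>.  The parallel class of \<open>\<langle>e\<^sub>2\<rangle>\<close>, the lines with constant \<open>b\<close>, will be \<open>\<ell>\<close>.\<close>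

locale symplectic_frame = symplectic_space \<beta> for \<beta> :: "'a::{field,finite} ^ 4 \<Rightarrow> 'a ^ 4 \<Rightarrow> 'a" +
  fixes e0 e1 e2 e3 :: "'a ^ 4"
  assumes frame: "\<beta> e0 e1 = 0" "\<beta> e0 e2 = 0" "\<beta> e0 e3 = 1" "\<beta> e1 e2 = 1" "\<beta> e1 e3 = 0" "\<beta> e2 e3 = 0"
begin

definition vc :: "'a \<Rightarrow> 'a \<Rightarrow> 'a \<Rightarrow> 'a \<Rightarrow> 'a ^ 4" where
  "vc a b c d = a *s e0 + b *s e1 + c *s e2 + d *s e3"

lemma frame_skew: "\<beta> e1 e0 = 0" "\<beta> e2 e0 = 0" "\<beta> e3 e0 = -1" "\<beta> e2 e1 = -1" "\<beta> e3 e1 = 0" "\<beta> e3 e2 = 0"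
  using frame form_skew[of e1 e0] form_skew[of e2 e0] form_skew[of e3 e0] form_skew[of e2 e1]
    form_skew[of e3 e1] form_skew[of e3 e2] by auto

lemma form_vc: "\<beta> (vc a b c d) (vc a' b' c' d') = a * d' - d * a' + b * c' - c * b'"
  unfolding vc_def by (simp only: form_linear form_self frame frame_skew) (simp add: algebra_simps)

lemma form_frame_vc:
  "\<beta> (vc a b c d) e3 = a" "\<beta> (vc a b c d) e2 = b" "\<beta> e1 (vc a b c d) = c" "\<beta> e0 (vc a b c d) = d"
  unfolding vc_def by (simp_all only: form_linear form_self frame frame_skew) simp_all

lemma vc_eq_iff [simp]: "vc a b c d = vc a' b' c' d' \<longleftrightarrow> a = a' \<and> b = b' \<and> c = c' \<and> d = d'"
proof
  assume eq: "vc a b c d = vc a' b' c' d'"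
  show "a = a' \<and> b = b' \<and> c = c' \<and> d = d'"
    using form_frame_vc[of a b c d] form_frame_vc[of a' b' c' d'] unfolding eq by simp
qed simp

lemma scale_vc: "t *s vc a b c d = vc (t * a) (t * b) (t * c) (t * d)"
  by (simp add: vc_def vec.scale_right_distrib)

lemma add_vc: "vc a b c d + vc a' b' c' d' = vc (a + a') (b + b') (c + c') (d + d')"
  by (simp add: vc_def vec.scale_left_distrib algebra_simps)

lemma vc_zero [simp]: "vc a b c d = 0 \<longleftrightarrow> a = 0 \<and> b = 0 \<and> c = 0 \<and> d = 0"
proof -
  have "vc 0 0 0 0 = 0" by (simp add: vc_def)
  then show ?thesis using vc_eq_iff[of a b c d 0 0 0 0] by simp
qed

text \<open>Coefficients are recovered by the form, so distinct tuples give distinct vectors; the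
  \<open>q^4\<close> tuples then exhaust the space.\<close>

lemma vc_cases: obtains a b c d where "v = vc a b c d"
proof -
  let ?f = "\<lambda>(a, b, c, d). vc a b c d"
  have "inj ?f" by (auto intro!: injI)
  then have "card (range ?f) = card (UNIV :: ('a \<times> 'a \<times> 'a \<times> 'a) set)" by (rule card_image)
  also have "\<dots> = card (UNIV :: ('a ^ 4) set)"
    by (simp add: card_cartesian_product power4_eq_xxxx flip: UNIV_Times_UNIV)
  finally have "range ?f = UNIV" by (intro card_subset_eq) auto
  then have "v \<in> range ?f" by simp
  then show ?thesis using that by auto
qed

definition pp :: "'a \<Rightarrow> 'a \<Rightarrow> 'a \<Rightarrow> 'a \<Rightarrow> 'a pg_point" where
  "pp a b c d = proj (vc a b c d)"

abbreviation x :: "'a pg_point" where "x \<equiv> pp 1 0 0 0"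

lemma proj_e0: "proj e0 = x"
  by (simp add: pp_def vc_def)

lemma pp_eq_iff:
  assumes "a \<noteq> 0 \<or> b \<noteq> 0 \<or> c \<noteq> 0 \<or> d \<noteq> 0"
  shows "pp a b c d = pp a' b' c' d' \<longleftrightarrow> (\<exists>t. t \<noteq> 0 \<and> a' = t * a \<and> b' = t * b \<and> c' = t * c \<and> d' = t * d)"
  using assms unfolding pp_def by (subst proj_eq_iff) (simp_all add: scale_vc)

lemma PG_cases:
  assumes "P \<in> PG_points"
  obtains a b c d where "P = pp a b c d" "a \<noteq> 0 \<or> b \<noteq> 0 \<or> c \<noteq> 0 \<or> d \<noteq> 0"
proof -
  obtain v where v: "P = proj v" "v \<noteq> 0" using assms by (auto simp: PG_points_eq)
  obtain a b c d where "v = vc a b c d" by (rule vc_cases)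
  then show ?thesis using that[of a b c d] v by (auto simp: pp_def)
qed

lemma pp_PG [simp]: "pp a b c d \<in> PG_points \<longleftrightarrow> a \<noteq> 0 \<or> b \<noteq> 0 \<or> c \<noteq> 0 \<or> d \<noteq> 0"
  by (auto simp: pp_def)

lemma collinear_pp:
  assumes "a \<noteq> 0 \<or> b \<noteq> 0 \<or> c \<noteq> 0 \<or> d \<noteq> 0" "a' \<noteq> 0 \<or> b' \<noteq> 0 \<or> c' \<noteq> 0 \<or> d' \<noteq> 0"
  shows "collinear_pts (W \<beta>) (pp a b c d) (pp a' b' c' d') \<longleftrightarrow> a * d' - d * a' + b * c' - c * b' = 0"
  using assms unfolding pp_def by (subst collinear_proj_iff) (simp_all add: form_vc)

lemma collinear_x_pp:
  assumes "a \<noteq> 0 \<or> b \<noteq> 0 \<or> c \<noteq> 0 \<or> d \<noteq> 0"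
  shows "collinear_pts (W \<beta>) x (pp a b c d) \<longleftrightarrow> d = 0"
  using collinear_pp[of 1 0 0 0 a b c d] assms by simp

definition aff :: "'a \<Rightarrow> 'a \<Rightarrow> 'a \<Rightarrow> 'a pg_point" where
  "aff a b c = pp a b c 1"

lemma aff_PG [simp]: "aff a b c \<in> PG_points"
  by (simp add: aff_def)

lemma aff_eq_iff [simp]: "aff a b c = aff a' b' c' \<longleftrightarrow> a = a' \<and> b = b' \<and> c = c'"
  unfolding aff_def by (subst pp_eq_iff) auto

lemma not_collinear_x_cases:
  assumes "z \<in> PG_points" "\<not> collinear_pts (W \<beta>) x z"
  obtains a b c where "z = aff a b c"
proof -
  obtain a b c d where z: "z = pp a b c d" "a \<noteq> 0 \<or> b \<noteq> 0 \<or> c \<noteq> 0 \<or> d \<noteq> 0"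
    using assms(1) by (rule PG_cases)
  then have "d \<noteq> 0" using assms(2) collinear_x_pp by blast
  then have "z = aff (a / d) (b / d) (c / d)"
    unfolding z aff_def using z(2) by (subst pp_eq_iff) (auto intro!: exI[of _ "1 / d"])
  then show ?thesis by (rule that)
qed

lemma not_collinear_x_aff [simp]: "\<not> collinear_pts (W \<beta>) x (aff a b c)"
  unfolding aff_def by (subst collinear_x_pp) auto

lemma pts_payne: "pts (payne_derived \<beta> x) = {z \<in> PG_points. \<not> collinear_pts (W \<beta>) x z}"
  by (simp add: payne_derived_def)

lemma payne_pts_cases:
  assumes "z \<in> pts (payne_derived \<beta> x)"
  obtains a b c where "z = aff a b c"
  using not_collinear_x_cases[of z] that assms unfolding pts_payne by auto

lemma aff_payne [simp]: "aff a b c \<in> pts (payne_derived \<beta> x)"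
  by (simp add: pts_payne)

section \<open>Coordinates for the affine plane \<Pi>(x)\<close>

definition ln :: "'a \<Rightarrow> 'a \<Rightarrow> 'a \<Rightarrow> 'a pg_point" where
  "ln w0 w1 w2 = pp w0 w1 w2 0"

text \<open>The equation for the first coordinate is orthogonality of \<open>(w0, w1, w2, 0)\<close>
  to \<open>(z, b, c, 1)\<close>. Since \<open>z\<close> drops out, the \<open>q\<close> points
  \<open>aff z b c\<close> of P(q) lie above one point of \<Pi>(x).\<close>

definition pt :: "'a \<Rightarrow> 'a \<Rightarrow> 'a pg_set" where
  "pt b c = {ln (b * w2 - c * w1) w1 w2 | w1 w2. w1 \<noteq> 0 \<or> w2 \<noteq> 0}"

lemma ln_eq_iff:
  assumes "w1 \<noteq> 0 \<or> w2 \<noteq> 0"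
  shows "ln w0 w1 w2 = ln v0 v1 v2 \<longleftrightarrow> (\<exists>t. t \<noteq> 0 \<and> v0 = t * w0 \<and> v1 = t * w1 \<and> v2 = t * w2)"
  unfolding ln_def using assms by (subst pp_eq_iff) auto

lemma ln_in_pt_iff:
  assumes "w1 \<noteq> 0 \<or> w2 \<noteq> 0"
  shows "ln w0 w1 w2 \<in> pt b c \<longleftrightarrow> w0 = b * w2 - c * w1"
proof
  assume "ln w0 w1 w2 \<in> pt b c"
  then obtain v1 v2 where "ln w0 w1 w2 = ln (b * v2 - c * v1) v1 v2" "v1 \<noteq> 0 \<or> v2 \<noteq> 0"
    by (auto simp: pt_def)
  then obtain t where t: "t \<noteq> 0" "b * v2 - c * v1 = t * w0" "v1 = t * w1" "v2 = t * w2"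
    using ln_eq_iff[OF assms] by blast
  then have "t * (b * w2 - c * w1) = t * w0" by (simp add: algebra_simps)
  then show "w0 = b * w2 - c * w1" using t(1) by simp
next
  assume "w0 = b * w2 - c * w1"
  then show "ln w0 w1 w2 \<in> pt b c" using assms by (auto simp: pt_def)
qed

lemma perp_x: "perp (W \<beta>) {x} = {pp w0 w1 w2 0 | w0 w1 w2. w0 \<noteq> 0 \<or> w1 \<noteq> 0 \<or> w2 \<noteq> 0}"
proof (rule Set.set_eqI)
  fix y show "y \<in> perp (W \<beta>) {x} \<longleftrightarrow> y \<in> {pp w0 w1 w2 0 | w0 w1 w2. w0 \<noteq> 0 \<or> w1 \<noteq> 0 \<or> w2 \<noteq> 0}"
  proof
    assume "y \<in> perp (W \<beta>) {x}"
    then have y: "y \<in> PG_points" "collinear_pts (W \<beta>) x y" by (auto simp: perp_def)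
    obtain a b c d where abcd: "y = pp a b c d" "a \<noteq> 0 \<or> b \<noteq> 0 \<or> c \<noteq> 0 \<or> d \<noteq> 0"
      using y(1) by (rule PG_cases)
    then have "d = 0" using y(2) collinear_x_pp by blast
    then show "y \<in> {pp w0 w1 w2 0 | w0 w1 w2. w0 \<noteq> 0 \<or> w1 \<noteq> 0 \<or> w2 \<noteq> 0}" using abcd by blast
  next
    assume "y \<in> {pp w0 w1 w2 0 | w0 w1 w2. w0 \<noteq> 0 \<or> w1 \<noteq> 0 \<or> w2 \<noteq> 0}"
    then obtain w0 w1 w2 where w: "y = pp w0 w1 w2 0" "w0 \<noteq> 0 \<or> w1 \<noteq> 0 \<or> w2 \<noteq> 0" by blast
    show "y \<in> perp (W \<beta>) {x}" using w(2) unfolding w(1) perp_def by (simp add: collinear_x_pp)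
  qed
qed

lemma ln_neq_x: "w1 \<noteq> 0 \<or> w2 \<noteq> 0 \<Longrightarrow> ln w0 w1 w2 \<noteq> x"
  unfolding ln_def by (subst pp_eq_iff) auto

lemma ln_zero_zero: "w0 \<noteq> 0 \<Longrightarrow> ln w0 0 0 = x"
  unfolding ln_def by (subst pp_eq_iff) (auto intro!: exI[of _ "1 / w0"])

lemma lns_Pi: "lns (Pi_plane \<beta> x) = {ln w0 w1 w2 | w0 w1 w2. w1 \<noteq> 0 \<or> w2 \<noteq> 0}"
proof -
  have lns: "lns (Pi_plane \<beta> x) = {ln w0 w1 w2 | w0 w1 w2. w0 \<noteq> 0 \<or> w1 \<noteq> 0 \<or> w2 \<noteq> 0} - {x}"
    unfolding Pi_plane_def ln_def by (simp only: incidence_structure.simps perp_x)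
  show ?thesis
  proof
    show "lns (Pi_plane \<beta> x) \<subseteq> {ln w0 w1 w2 | w0 w1 w2. w1 \<noteq> 0 \<or> w2 \<noteq> 0}"
    proof
      fix l assume "l \<in> lns (Pi_plane \<beta> x)"
      then have "l \<in> {ln w0 w1 w2 | w0 w1 w2. w0 \<noteq> 0 \<or> w1 \<noteq> 0 \<or> w2 \<noteq> 0}" "l \<noteq> x"
        unfolding lns by simp_all
      then obtain w0 w1 w2 where l: "l = ln w0 w1 w2" "w0 \<noteq> 0 \<or> w1 \<noteq> 0 \<or> w2 \<noteq> 0" by blast
      moreover have "w1 \<noteq> 0 \<or> w2 \<noteq> 0"
      proof (rule ccontr)
        assume "\<not> (w1 \<noteq> 0 \<or> w2 \<noteq> 0)"
        then have "l = x" using l ln_zero_zero[of w0] by simp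
        then show False using \<open>l \<noteq> x\<close> by simp
      qed
      ultimately show "l \<in> {ln w0 w1 w2 | w0 w1 w2. w1 \<noteq> 0 \<or> w2 \<noteq> 0}" by blast
    qed
    show "{ln w0 w1 w2 | w0 w1 w2. w1 \<noteq> 0 \<or> w2 \<noteq> 0} \<subseteq> lns (Pi_plane \<beta> x)"
    proof
      fix l assume "l \<in> {ln w0 w1 w2 | w0 w1 w2. w1 \<noteq> 0 \<or> w2 \<noteq> 0}"
      then obtain w0 w1 w2 where l: "l = ln w0 w1 w2" "w1 \<noteq> 0 \<or> w2 \<noteq> 0" by blast
      show "l \<in> lns (Pi_plane \<beta> x)"
        using ln_neq_x[OF l(2)] l(2) unfolding l(1) lns by blast
    qed
  qed
qed

lemma lns_Pi_cases:
  assumes "l \<in> lns (Pi_plane \<beta> x)"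
  obtains w0 w1 w2 where "l = ln w0 w1 w2" "w1 \<noteq> 0 \<or> w2 \<noteq> 0"
  using assms unfolding lns_Pi by blast

lemma ln_Pi: "w1 \<noteq> 0 \<or> w2 \<noteq> 0 \<Longrightarrow> ln w0 w1 w2 \<in> lns (Pi_plane \<beta> x)"
  unfolding lns_Pi by blast

lemma perp_x_aff: "perp (W \<beta>) {x, aff a b c} = pt b c"
proof -
  have "perp (W \<beta>) {x, aff a b c} = {y \<in> perp (W \<beta>) {x}. collinear_pts (W \<beta>) (aff a b c) y}"
    by (auto simp: perp_def)
  also have "\<dots> = {pp w0 w1 w2 0 | w0 w1 w2. (w0 \<noteq> 0 \<or> w1 \<noteq> 0 \<or> w2 \<noteq> 0) \<and> w0 = b * w2 - c * w1}"
  proof -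
    have "collinear_pts (W \<beta>) (aff a b c) (pp w0 w1 w2 0) \<longleftrightarrow> w0 = b * w2 - c * w1"
      if "w0 \<noteq> 0 \<or> w1 \<noteq> 0 \<or> w2 \<noteq> 0" for w0 w1 w2
      unfolding aff_def using that by (subst collinear_pp) (auto simp: algebra_simps)
    then show ?thesis unfolding perp_x by blast
  qed
  also have "\<dots> = pt b c"
  proof -
    have "w0 = b * w2 - c * w1 \<Longrightarrow> w0 \<noteq> 0 \<or> w1 \<noteq> 0 \<or> w2 \<noteq> 0 \<longleftrightarrow> w1 \<noteq> 0 \<or> w2 \<noteq> 0" for w0 w1 w2
      by auto
    then show ?thesis unfolding pt_def ln_def by blast
  qed
  finally show ?thesis .
qed

lemma pts_Pi: "pts (Pi_plane \<beta> x) = {pt b c | b c. True}"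
proof -
  have "pts (Pi_plane \<beta> x) = {perp (W \<beta>) {x, z} | z. z \<in> PG_points \<and> \<not> collinear_pts (W \<beta>) x z}"
    by (simp add: Pi_plane_def)
  also have "\<dots> = {perp (W \<beta>) {x, aff a b c} | a b c. True}"
  proof (intro equalityI subsetI)
    fix p assume "p \<in> {perp (W \<beta>) {x, z} | z. z \<in> PG_points \<and> \<not> collinear_pts (W \<beta>) x z}"
    then obtain z where z: "p = perp (W \<beta>) {x, z}" "z \<in> PG_points" "\<not> collinear_pts (W \<beta>) x z" by blast
    obtain a b c where "z = aff a b c" using z(2,3) by (rule not_collinear_x_cases)
    then show "p \<in> {perp (W \<beta>) {x, aff a b c} | a b c. True}" using z(1) by blast
  next
    fix p assume "p \<in> {perp (W \<beta>) {x, aff a b c} | a b c. True}"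
    then show "p \<in> {perp (W \<beta>) {x, z} | z. z \<in> PG_points \<and> \<not> collinear_pts (W \<beta>) x z}"
      using not_collinear_x_aff aff_PG by blast
  qed
  finally show ?thesis by (simp add: perp_x_aff)
qed

lemma pt_Pi [simp]: "pt b c \<in> pts (Pi_plane \<beta> x)"
  unfolding pts_Pi by blast

lemma inc_Pi [simp]: "inc (Pi_plane \<beta> x) p l \<longleftrightarrow> l \<in> p"
  by (simp add: Pi_plane_def)

lemma pt_eq_iff [simp]: "pt b c = pt b' c' \<longleftrightarrow> b = b' \<and> c = c'"
proof
  assume eq: "pt b c = pt b' c'"
  have "ln b 0 1 \<in> pt b c" "ln (- c) 1 0 \<in> pt b c" by (simp_all add: ln_in_pt_iff)
  then show "b = b' \<and> c = c'" unfolding eq by (simp add: ln_in_pt_iff)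
qed simp

text \<open>\<open>(w1, w2)\<close> is the direction of a line: two of its points differ by a
  multiple of this vector. Parallelism is proportionality of directions.\<close>

lemma parallel_ln_iff:
  assumes "w1 \<noteq> 0 \<or> w2 \<noteq> 0" "v1 \<noteq> 0 \<or> v2 \<noteq> 0"
  shows "parallel (Pi_plane \<beta> x) (ln w0 w1 w2) (ln v0 v1 v2) \<longleftrightarrow> w1 * v2 = w2 * v1"
proof
  assume par: "parallel (Pi_plane \<beta> x) (ln w0 w1 w2) (ln v0 v1 v2)"
  show "w1 * v2 = w2 * v1"
  proof (rule ccontr)
    define D where "D = w1 * v2 - w2 * v1"
    assume "w1 * v2 \<noteq> w2 * v1"
    then have D: "D \<noteq> 0" by (simp add: D_def)
    \<comment> \<open>Cramer's rule for the common point of two lines with independent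
      directions.\<close>
    define b where "b = (v0 * w1 - w0 * v1) / D"
    define c where "c = (v0 * w2 - w0 * v2) / D"
    have "b * w2 - c * w1 = w0"
    proof -
      have "b * w2 - c * w1 = ((v0 * w1 - w0 * v1) * w2 - (v0 * w2 - w0 * v2) * w1) / D"
        unfolding b_def c_def by (simp only: times_divide_eq_left diff_divide_distrib[symmetric])
      also have "(v0 * w1 - w0 * v1) * w2 - (v0 * w2 - w0 * v2) * w1 = w0 * D"
        by (simp add: D_def algebra_simps)
      finally show ?thesis using D by simp
    qed
    moreover have "b * v2 - c * v1 = v0"
    proof -
      have "b * v2 - c * v1 = ((v0 * w1 - w0 * v1) * v2 - (v0 * w2 - w0 * v2) * v1) / D"
        unfolding b_def c_def by (simp only: times_divide_eq_left diff_divide_distrib[symmetric])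
      also have "(v0 * w1 - w0 * v1) * v2 - (v0 * w2 - w0 * v2) * v1 = v0 * D"
        by (simp add: D_def algebra_simps)
      finally show ?thesis using D by simp
    qed
    ultimately have "ln w0 w1 w2 \<in> pt b c" "ln v0 v1 v2 \<in> pt b c"
      using assms by (simp_all add: ln_in_pt_iff)
    moreover from this par have "ln w0 w1 w2 = ln v0 v1 v2"
      unfolding parallel_def by auto
    then obtain t where "v1 = t * w1" "v2 = t * w2" using ln_eq_iff[OF assms(1)] by blast
    then show False using D by (simp add: D_def algebra_simps)
  qed
next
  assume eq: "w1 * v2 = w2 * v1"
  obtain t where t: "t \<noteq> 0" "v1 = t * w1" "v2 = t * w2"
  proof (cases "w1 = 0")
    case True
    then have "w2 \<noteq> 0" "v1 = 0" using assms eq by auto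
    then show ?thesis using that[of "v2 / w2"] True assms(2) by auto
  next
    case False
    then have "v2 = v1 / w1 * w2" using eq by (simp add: field_simps)
    moreover have "v1 \<noteq> 0" using eq False assms(2) by auto
    ultimately show ?thesis using that[of "v1 / w1"] False by simp
  qed
  show "parallel (Pi_plane \<beta> x) (ln w0 w1 w2) (ln v0 v1 v2)"
    unfolding parallel_def
  proof (rule disjCI)
    assume "\<not> (\<nexists>p. p \<in> pts (Pi_plane \<beta> x) \<and> inc (Pi_plane \<beta> x) p (ln w0 w1 w2) \<and>
      inc (Pi_plane \<beta> x) p (ln v0 v1 v2))"
    then obtain b c where "ln w0 w1 w2 \<in> pt b c" "ln v0 v1 v2 \<in> pt b c"
      by (auto simp: pts_Pi)
    then have "v0 = b * v2 - c * v1" "w0 = b * w2 - c * w1"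
      using assms by (simp_all add: ln_in_pt_iff)
    then have "v0 = t * w0" unfolding t(2,3) by (simp add: right_diff_distrib mult.left_commute)
    then show "ln w0 w1 w2 = ln v0 v1 v2" using ln_eq_iff[OF assms(1)] t by blast
  qed
qed

text \<open>Both lines have the direction \<open>(b - b', c - c')\<close>, so they are parallel, and
  parallel lines with a common point coincide.\<close>

lemma two_points_line_unique:
  assumes "ln w0 w1 w2 \<in> pt b c" "ln w0 w1 w2 \<in> pt b' c'" "ln v0 v1 v2 \<in> pt b c" "ln v0 v1 v2 \<in> pt b' c'"
    and "b \<noteq> b' \<or> c \<noteq> c'" and w: "w1 \<noteq> 0 \<or> w2 \<noteq> 0" and v: "v1 \<noteq> 0 \<or> v2 \<noteq> 0"
  shows "ln w0 w1 w2 = ln v0 v1 v2"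
proof -
  have e: "w0 = b * w2 - c * w1" "w0 = b' * w2 - c' * w1" "v0 = b * v2 - c * v1" "v0 = b' * v2 - c' * v1"
    using assms by (simp_all add: ln_in_pt_iff)
  have 1: "(b - b') * w2 = (c - c') * w1" using e(1,2) by (simp add: algebra_simps)
  have 2: "(b - b') * v2 = (c - c') * v1" using e(3,4) by (simp add: algebra_simps)
  have "w1 * v2 = w2 * v1"
  proof (cases "b = b'")
    case True
    then have "c - c' \<noteq> 0" using assms(5) by simp
    then have "w1 = 0" "v1 = 0" using 1 2 True by auto
    then show ?thesis by simp
  next
    case False
    have "(b - b') * (w1 * v2) = w1 * ((b - b') * v2)" by (simp add: algebra_simps)
    also have "\<dots> = v1 * ((b - b') * w2)" unfolding 1 2 by (simp add: algebra_simps)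
    also have "\<dots> = (b - b') * (w2 * v1)" by (simp add: algebra_simps)
    finally show ?thesis using False by simp
  qed
  then have "parallel (Pi_plane \<beta> x) (ln w0 w1 w2) (ln v0 v1 v2)" using parallel_ln_iff w v by blast
  then show ?thesis using assms(1,3) pt_Pi[of b c] unfolding parallel_def by auto
qed

sublocale Pi: affine_plane_incidence "Pi_plane \<beta> x"
proof
  fix p r assume "p \<in> pts (Pi_plane \<beta> x)" "r \<in> pts (Pi_plane \<beta> x)"
  then obtain b c b' c' where pr: "p = pt b c" "r = pt b' c'" by (auto simp: pts_Pi)
  \<comment> \<open>The direction of the join is the difference of the two points; if the points
    coincide any nonzero direction will do, here \<open>(1, 1)\<close>.\<close>
  define w1 where "w1 = (if b = b' \<and> c = c' then 1 else b - b')"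
  define w2 where "w2 = (if b = b' \<and> c = c' then 1 else c - c')"
  have w: "w1 \<noteq> 0 \<or> w2 \<noteq> 0" by (auto simp: w1_def w2_def)
  have "b * w2 - c * w1 = b' * w2 - c' * w1"
    by (cases "b = b' \<and> c = c'") (auto simp: w1_def w2_def algebra_simps)
  then have "ln (b * w2 - c * w1) w1 w2 \<in> p" "ln (b * w2 - c * w1) w1 w2 \<in> r"
    unfolding pr using w by (simp_all add: ln_in_pt_iff)
  then show "\<exists>l\<in>lns (Pi_plane \<beta> x). inc (Pi_plane \<beta> x) p l \<and> inc (Pi_plane \<beta> x) r l"
    using ln_Pi[OF w] by auto
next
  fix p r l m
  assume pr: "p \<in> pts (Pi_plane \<beta> x)" "r \<in> pts (Pi_plane \<beta> x)" and "p \<noteq> r"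
    and l: "l \<in> lns (Pi_plane \<beta> x)" and m: "m \<in> lns (Pi_plane \<beta> x)"
    and i: "inc (Pi_plane \<beta> x) p l" "inc (Pi_plane \<beta> x) r l" "inc (Pi_plane \<beta> x) p m" "inc (Pi_plane \<beta> x) r m"
  from pr obtain b c b' c' where bc: "p = pt b c" "r = pt b' c'" by (auto simp: pts_Pi)
  obtain w0 w1 w2 where w: "l = ln w0 w1 w2" "w1 \<noteq> 0 \<or> w2 \<noteq> 0" using l by (rule lns_Pi_cases)
  obtain v0 v1 v2 where v: "m = ln v0 v1 v2" "v1 \<noteq> 0 \<or> v2 \<noteq> 0" using m by (rule lns_Pi_cases)
  show "l = m"
    unfolding w v by (rule two_points_line_unique[of _ _ _ b c b' c'])
      (use i \<open>p \<noteq> r\<close> bc w v in auto)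
next
  fix p l assume p: "p \<in> pts (Pi_plane \<beta> x)" and l: "l \<in> lns (Pi_plane \<beta> x)"
  from p obtain b c where bc: "p = pt b c" by (auto simp: pts_Pi)
  obtain w0 w1 w2 where w: "l = ln w0 w1 w2" "w1 \<noteq> 0 \<or> w2 \<noteq> 0" using l by (rule lns_Pi_cases)
  show "\<exists>m\<in>lns (Pi_plane \<beta> x). inc (Pi_plane \<beta> x) p m \<and> parallel (Pi_plane \<beta> x) l m"
    by (rule bexI[of _ "ln (b * w2 - c * w1) w1 w2"])
      (use w in \<open>simp_all add: bc ln_in_pt_iff parallel_ln_iff ln_Pi\<close>)
next
  fix k l m
  assume k: "k \<in> lns (Pi_plane \<beta> x)" and l: "l \<in> lns (Pi_plane \<beta> x)" and m: "m \<in> lns (Pi_plane \<beta> x)"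
    and p: "parallel (Pi_plane \<beta> x) k l" "parallel (Pi_plane \<beta> x) k m"
  obtain u0 u1 u2 where u: "k = ln u0 u1 u2" "u1 \<noteq> 0 \<or> u2 \<noteq> 0" using k by (rule lns_Pi_cases)
  obtain v0 v1 v2 where v: "l = ln v0 v1 v2" "v1 \<noteq> 0 \<or> v2 \<noteq> 0" using l by (rule lns_Pi_cases)
  obtain w0 w1 w2 where w: "m = ln w0 w1 w2" "w1 \<noteq> 0 \<or> w2 \<noteq> 0" using m by (rule lns_Pi_cases)
  have e: "u1 * v2 = u2 * v1" "u1 * w2 = u2 * w1"
    using p u v w parallel_ln_iff by blast+
  have "u1 * (v1 * w2) = u1 * (v2 * w1)" "u2 * (v1 * w2) = u2 * (v2 * w1)"
    using e by (metis mult.assoc mult.commute)+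
  then have "v1 * w2 = v2 * w1" using u(2) by auto
  then show "parallel (Pi_plane \<beta> x) l m" using v w parallel_ln_iff by blast
next
  show "lns (Pi_plane \<beta> x) \<noteq> {}" using ln_Pi[of 1 0 0] by auto
qed


section \<open>Ideal points of \<Pi>(x)\<close>

abbreviation C :: "(('a pg_set, 'a pg_point) cpoint, 'a pg_point cline) incidence_structure" where
  "C \<equiv> Pi_completion \<beta> x"

text \<open>Ideal points are named by their direction; by \<open>parallel_class_ln\<close> the first
  coordinate \<open>0\<close> of the representative is immaterial. The point \<ell> will be
  \<open>cls 0 1\<close>.\<close>

definition cls :: "'a \<Rightarrow> 'a \<Rightarrow> 'a pg_point set" where
  "cls w1 w2 = parallel_class (Pi_plane \<beta> x) (ln 0 w1 w2)"

lemma ln_in_cls_iff: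
  assumes "w1 \<noteq> 0 \<or> w2 \<noteq> 0" "v1 \<noteq> 0 \<or> v2 \<noteq> 0"
  shows "ln v0 v1 v2 \<in> cls w1 w2 \<longleftrightarrow> w1 * v2 = w2 * v1"
  using assms by (simp add: cls_def ln_Pi parallel_ln_iff)

lemma parallel_class_ln:
  assumes "w1 \<noteq> 0 \<or> w2 \<noteq> 0"
  shows "parallel_class (Pi_plane \<beta> x) (ln w0 w1 w2) = cls w1 w2"
  unfolding cls_def
  by (rule Pi.parallel_class_eq) (use assms in \<open>simp_all add: ln_Pi parallel_ln_iff\<close>)

lemma cls_eq_iff:
  assumes "w1 \<noteq> 0 \<or> w2 \<noteq> 0" "v1 \<noteq> 0 \<or> v2 \<noteq> 0"
  shows "cls w1 w2 = cls v1 v2 \<longleftrightarrow> w1 * v2 = w2 * v1"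
proof
  assume eq: "cls w1 w2 = cls v1 v2"
  have "ln 0 v1 v2 \<in> cls v1 v2" using assms(2) by (simp add: ln_in_cls_iff)
  then show "w1 * v2 = w2 * v1" using assms unfolding eq[symmetric] by (simp add: ln_in_cls_iff)
next
  assume "w1 * v2 = w2 * v1"
  then show "cls w1 w2 = cls v1 v2"
    unfolding cls_def using assms by (intro Pi.parallel_class_eq) (simp_all add: ln_Pi parallel_ln_iff)
qed

lemma Ideal_cls [simp]: "w1 \<noteq> 0 \<or> w2 \<noteq> 0 \<Longrightarrow> Ideal_Point (cls w1 w2) \<in> pts C"
  unfolding Ideal_Point_completion cls_def using ln_Pi by blast

lemma Ideal_cases:
  assumes "Ideal_Point c \<in> pts C"
  obtains w1 w2 where "c = cls w1 w2" "w1 \<noteq> 0 \<or> w2 \<noteq> 0"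
proof -
  obtain l where l: "l \<in> lns (Pi_plane \<beta> x)" "c = parallel_class (Pi_plane \<beta> x) l"
    using assms unfolding Ideal_Point_completion by blast
  obtain w0 w1 w2 where w: "l = ln w0 w1 w2" "w1 \<noteq> 0 \<or> w2 \<noteq> 0" using l(1) by (rule lns_Pi_cases)
  show ?thesis using l(2) w(2) unfolding w(1) parallel_class_ln[OF w(2)] by (rule that)
qed

lemma C_cases:
  assumes "P \<in> pts C"
  obtains b c where "P = Affine_Point (pt b c)"
  | w1 w2 where "P = Ideal_Point (cls w1 w2)" "w1 \<noteq> 0 \<or> w2 \<noteq> 0"
proof (cases P)
  case (Affine_Point p)
  then have "p \<in> pts (Pi_plane \<beta> x)" using assms by simp
  then obtain b c where "p = pt b c" unfolding pts_Pi by blast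
  then show ?thesis using that(1) Affine_Point by blast
next
  case (Ideal_Point c)
  then have "Ideal_Point c \<in> pts C" using assms by simp
  then obtain w1 w2 where "c = cls w1 w2" "w1 \<noteq> 0 \<or> w2 \<noteq> 0" by (rule Ideal_cases)
  then show ?thesis using that(2) Ideal_Point by blast
qed

lemma C_map_eqI:
  assumes "f \<in> extensional (pts C)" "g \<in> extensional (pts C)"
    and "\<And>b c. f (Affine_Point (pt b c)) = g (Affine_Point (pt b c))"
    and "\<And>w1 w2. w1 \<noteq> 0 \<or> w2 \<noteq> 0 \<Longrightarrow> f (Ideal_Point (cls w1 w2)) = g (Ideal_Point (cls w1 w2))"
  shows "f = g"
proof (rule extensionalityI[OF assms(1,2)])
  fix P assume "P \<in> pts C"
  then show "f P = g P" by (rule C_cases) (simp_all add: assms(3,4))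
qed


subsection \<open>The group of order \<open>q\<^sup>4\<close>\<close>

text \<open>The shear with parameter \<open>m\<close> on the two middle coordinates and the
  displacement \<open>(a, k)\<close> are free; invariance of the form then forces the coefficients
  \<open>a\<close> and \<open>m * a - k\<close> in the first coordinate, while \<open>s\<close>
  stays free. The values \<open>\<beta> v e3\<close>, \<open>\<beta> v e2\<close>,
  \<open>\<beta> e1 v\<close>, \<open>\<beta> e0 v\<close> are the four coordinates of
  \<open>v\<close>.\<close>

definition T :: "'a \<Rightarrow> 'a \<Rightarrow> 'a \<Rightarrow> 'a \<Rightarrow> 'a ^ 4 \<Rightarrow> 'a ^ 4" where
  "T a m k s v =
     vc (\<beta> v e3 + a * \<beta> e1 v + (m * a - k) * \<beta> v e2 + s * \<beta> e0 v)
       (\<beta> v e2 + a * \<beta> e0 v) (\<beta> e1 v + m * \<beta> v e2 + k * \<beta> e0 v) (\<beta> e0 v)"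

lemma T_vc: "T a m k s (vc v0 v1 v2 v3) =
    vc (v0 + a * v2 + (m * a - k) * v1 + s * v3) (v1 + a * v3) (v2 + m * v1 + k * v3) v3"
  by (simp add: T_def form_frame_vc)

lemma T_add: "T a m k s (u + v) = T a m k s u + T a m k s v"
  by (rule vc_cases[of u], rule vc_cases[of v]) (simp add: add_vc T_vc algebra_simps)

lemma T_scale: "T a m k s (t *s v) = t *s T a m k s v"
  by (rule vc_cases[of v]) (simp add: scale_vc T_vc algebra_simps)

lemma T_linear: "Vector_Spaces.linear (*s) (*s) (T a m k s)"
  by unfold_locales (simp_all add: T_add T_scale)

lemma T_form: "\<beta> (T a m k s u) (T a m k s v) = \<beta> u v"
  by (rule vc_cases[of u], rule vc_cases[of v]) (simp add: T_vc form_vc algebra_simps)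

lemma T_T: "T a' m' k' s' (T a m k s v) =
    T (a + a') (m + m') (k + k' + m' * a) (s + s' + a' * k + (m' * a' - k') * a) v"
  by (rule vc_cases[of v]) (simp add: T_vc algebra_simps)

lemma T_zero: "T 0 0 0 0 v = v"
  by (rule vc_cases[of v]) (simp add: T_vc)

text \<open>The parameters are obtained by setting the result of \<open>T_T\<close> to zero; the
  summand \<open>m * a\<close> compensates the mixed term \<open>m' * a\<close> there.\<close>

lemma T_inverse:
  "T (- a) (- m) (m * a - k) (- s) (T a m k s v) = v"
  "T a m k s (T (- a) (- m) (m * a - k) (- s) v) = v"
  by (simp_all add: T_T T_zero[simplified] algebra_simps)

lemma T_eq_0_iff: "T a m k s v = 0 \<longleftrightarrow> v = 0"
  using T_inverse(1)[of a m k s v] T_scale[of _ _ _ _ 0 0] by (metis vec.scale_zero_left)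

lemma T_proj: "T a m k s ` proj v = proj (T a m k s v)"
  unfolding proj_def by (simp add: image_image T_scale)

definition tau :: "'a \<Rightarrow> 'a \<Rightarrow> 'a \<Rightarrow> 'a \<Rightarrow> 'a pg_point \<Rightarrow> 'a pg_point" where
  "tau a m k s = (\<lambda>P\<in>PG_points. T a m k s ` P)"

lemma tau_pp:
  assumes "v0 \<noteq> 0 \<or> v1 \<noteq> 0 \<or> v2 \<noteq> 0 \<or> v3 \<noteq> 0"
  shows "tau a m k s (pp v0 v1 v2 v3) =
    pp (v0 + a * v2 + (m * a - k) * v1 + s * v3) (v1 + a * v3) (v2 + m * v1 + k * v3) v3"
  unfolding tau_def using assms by (simp add: pp_def T_proj T_vc)

lemma tau_PG: "P \<in> PG_points \<Longrightarrow> tau a m k s P \<in> PG_points"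
  unfolding tau_def PG_points_eq by (auto simp: T_proj T_eq_0_iff)

lemma tau_extensional: "tau a m k s \<in> extensional PG_points"
  by (simp add: tau_def)

lemma tau_tau: "P \<in> PG_points \<Longrightarrow> tau a' m' k' s' (tau a m k s P) =
    tau (a + a') (m + m') (k + k' + m' * a) (s + s' + a' * k + (m' * a' - k') * a) P"
  using tau_PG[of P a m k s] by (simp add: tau_def image_image T_T)


lemma tau_zero: "tau 0 0 0 0 = (\<lambda>P\<in>PG_points. P)"
  by (simp add: tau_def T_zero)

lemma tau_inverse:
  assumes "P \<in> PG_points"
  shows "tau (- a) (- m) (m * a - k) (- s) (tau a m k s P) = P"
    "tau a m k s (tau (- a) (- m) (m * a - k) (- s) P) = P"
  using assms by (simp_all add: tau_tau tau_zero algebra_simps)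

lemma tau_inj: "inj_on (tau a m k s) PG_points"
  by (rule inj_on_inverseI[where g = "tau (- a) (- m) (m * a - k) (- s)"]) (rule tau_inverse(1))

lemma tau_subspace_points:
  "tau a m k s ` {P \<in> PG_points. P \<subseteq> L} = {P \<in> PG_points. P \<subseteq> T a m k s ` L}"
proof
  show "tau a m k s ` {P \<in> PG_points. P \<subseteq> L} \<subseteq> {P \<in> PG_points. P \<subseteq> T a m k s ` L}"
  proof
    fix Q assume "Q \<in> tau a m k s ` {P \<in> PG_points. P \<subseteq> L}"
    then obtain P where P: "P \<in> PG_points" "P \<subseteq> L" "Q = tau a m k s P" by blast
    then have "Q = T a m k s ` P" by (simp add: tau_def)
    moreover have "Q \<in> PG_points" using P tau_PG by simp
    ultimately show "Q \<in> {P \<in> PG_points. P \<subseteq> T a m k s ` L}" using P(2) by auto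
  qed
  show "{P \<in> PG_points. P \<subseteq> T a m k s ` L} \<subseteq> tau a m k s ` {P \<in> PG_points. P \<subseteq> L}"
  proof
    fix Q assume "Q \<in> {P \<in> PG_points. P \<subseteq> T a m k s ` L}"
    then have Q: "Q \<in> PG_points" "Q \<subseteq> T a m k s ` L" by auto
    let ?R = "tau (- a) (- m) (m * a - k) (- s) Q"
    have "?R = T (- a) (- m) (m * a - k) (- s) ` Q" using Q(1) by (simp add: tau_def)
    also have "\<dots> \<subseteq> T (- a) (- m) (m * a - k) (- s) ` T a m k s ` L" using Q(2) by (rule image_mono)
    finally have "?R \<subseteq> L" by (simp only: image_image T_inverse(1) image_ident)
    moreover have "Q = tau a m k s ?R" using tau_inverse(2)[OF Q(1)] by simp
    ultimately show "Q \<in> tau a m k s ` {P \<in> PG_points. P \<subseteq> L}" using tau_PG[OF Q(1)] by blast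
  qed
qed

lemma lns_W: "lns (W \<beta>) = {{P \<in> PG_points. P \<subseteq> L} | L.
    vec.subspace L \<and> vec.dim L = 2 \<and> totally_isotropic \<beta> L}"
  by (simp add: W_def)

lemma tau_automorphism: "tau a m k s \<in> automorphisms (W \<beta>)"
proof (rule automorphismI_image)
  have "bij_betw (tau a m k s) PG_points PG_points"
    by (rule bij_betw_finite_self[OF _ tau_inj]) (use tau_PG in auto)
  then show "tau a m k s \<in> Bij (pts (W \<beta>))"
    by (simp add: Bij_def tau_extensional)
  show "l \<subseteq> pts (W \<beta>)" if "l \<in> lns (W \<beta>)" for l
    using that unfolding lns_W pts_W by auto
  show "tau a m k s ` l \<in> lns (W \<beta>)" if l: "l \<in> lns (W \<beta>)" for l
  proof -
    obtain L where L: "l = {P \<in> PG_points. P \<subseteq> L}" "vec.subspace L" "vec.dim L = 2" "totally_isotropic \<beta> L"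
      using l unfolding lns_W mem_Collect_eq by (elim exE conjE) (rule that)
    have "inj (T a m k s)"
      by (rule inj_on_inverseI[where g = "T (- a) (- m) (m * a - k) (- s)"]) (rule T_inverse(1))
    then have "inj_on (T a m k s) (vec.span L)" by (rule inj_on_subset) simp
    then have "vec.dim (T a m k s ` L) = 2"
      using vec.dim_image_eq[OF T_linear] L(3) by simp
    moreover have "vec.subspace (T a m k s ` L)"
      using vec.linear_subspace_image[OF T_linear L(2)] .
    moreover have "totally_isotropic \<beta> (T a m k s ` L)"
      using L(4) by (auto simp: totally_isotropic_def T_form)
    ultimately show ?thesis unfolding L(1) tau_subspace_points lns_W
      by (intro CollectI exI[of _ "T a m k s ` L"] conjI refl)
  qed
qed (simp_all add: finite)

lemma tau_x: "tau a m k s x = x"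
  by (simp add: tau_pp)

lemma tau_aff: "tau a m k s (aff z b c) = aff (z + a * c + (m * a - k) * b + s) (b + a) (c + m * b + k)"
  unfolding aff_def by (simp add: tau_pp)

lemma tau_ln: "w1 \<noteq> 0 \<or> w2 \<noteq> 0 \<Longrightarrow>
    tau a m k s (ln w0 w1 w2) = ln (w0 + a * w2 + (m * a - k) * w1) w1 (w2 + m * w1)"
  unfolding ln_def by (simp add: tau_pp)

text \<open>\<open>pt b c\<close> is the perp of \<open>x\<close> together with any point above it,
  and \<open>tau\<close> fixes \<open>x\<close>; following the single representative
  \<open>aff 0 b c\<close> is therefore enough.\<close>

lemma tau_pt: "tau a m k s ` pt b c = pt (b + a) (c + m * b + k)"
  using automorphism_perp[OF tau_automorphism, of "{x, aff 0 b c}" a m k s]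
  by (simp add: perp_x_aff tau_x tau_aff)

lemma tau_cls:
  assumes w: "w1 \<noteq> 0 \<or> w2 \<noteq> 0"
  shows "tau a m k s ` cls w1 w2 = cls w1 (w2 + m * w1)"
proof -
  have w': "w1 \<noteq> 0 \<or> w2 + m * w1 \<noteq> 0" using w by auto
  have mem: "tau a m k s l \<in> cls w1 (w2 + m * w1) \<longleftrightarrow> l \<in> cls w1 w2" if l: "l \<in> lns (Pi_plane \<beta> x)" for l
  proof -
    obtain v0 v1 v2 where v: "l = ln v0 v1 v2" "v1 \<noteq> 0 \<or> v2 \<noteq> 0" using l by (rule lns_Pi_cases)
    have v': "v1 \<noteq> 0 \<or> v2 + m * v1 \<noteq> 0" using v(2) by auto
    show ?thesis unfolding v(1) tau_ln[OF v(2)] ln_in_cls_iff[OF w v(2)] ln_in_cls_iff[OF w' v']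
      by (simp add: algebra_simps)
  qed
  have pre: "l \<in> tau a m k s ` lns (Pi_plane \<beta> x)" if l: "l \<in> lns (Pi_plane \<beta> x)" for l
  proof -
    obtain v0 v1 v2 where v: "l = ln v0 v1 v2" "v1 \<noteq> 0 \<or> v2 \<noteq> 0" using l by (rule lns_Pi_cases)
    have v': "v1 \<noteq> 0 \<or> v2 - m * v1 \<noteq> 0" using v(2) by auto
    \<comment> \<open>The preimage comes from solving \<open>tau_ln\<close> backwards, undoing the
      shear first.\<close>
    have "l = tau a m k s (ln (v0 - a * (v2 - m * v1) - (m * a - k) * v1) v1 (v2 - m * v1))"
      unfolding v(1) tau_ln[OF v'] by (simp add: algebra_simps)
    then show ?thesis using ln_Pi[OF v'] by blast
  qed
  have sub: "cls v1 v2 \<subseteq> lns (Pi_plane \<beta> x)" for v1 v2 by (auto simp: cls_def)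
  show ?thesis
  proof
    show "tau a m k s ` cls w1 w2 \<subseteq> cls w1 (w2 + m * w1)" using mem sub by blast
    show "cls w1 (w2 + m * w1) \<subseteq> tau a m k s ` cls w1 w2"
    proof
      fix l assume l: "l \<in> cls w1 (w2 + m * w1)"
      then obtain n where "n \<in> lns (Pi_plane \<beta> x)" "l = tau a m k s n" using pre sub by blast
      then show "l \<in> tau a m k s ` cls w1 w2" using l mem by blast
    qed
  qed
qed


subsection \<open>The group \<open>H(\<ell>)\<close>\<close>

text \<open>The value \<open>s = 0\<close> selects one lift; by \<open>induced_tau\<close> every
  \<open>s\<close> induces the same map.\<close>

definition h :: "'a \<Rightarrow> 'a \<Rightarrow> 'a \<Rightarrow> 'a cpoint_map" where
  "h a m k = induced_on_Pi \<beta> x (tau a m k 0)"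

lemma h_extensional: "h a m k \<in> extensional (pts C)"
  by (simp add: h_def induced_on_Pi_def)

lemma induced_tau_Affine:
  "induced_on_Pi \<beta> x (tau a m k s) (Affine_Point (pt b c)) = Affine_Point (pt (b + a) (c + m * b + k))"
  by (simp add: induced_on_Pi_def tau_pt)

lemma induced_tau_Ideal:
  "w1 \<noteq> 0 \<or> w2 \<noteq> 0 \<Longrightarrow>
    induced_on_Pi \<beta> x (tau a m k s) (Ideal_Point (cls w1 w2)) = Ideal_Point (cls w1 (w2 + m * w1))"
  by (simp add: induced_on_Pi_def tau_cls)

lemma h_Affine: "h a m k (Affine_Point (pt b c)) = Affine_Point (pt (b + a) (c + m * b + k))"
  by (simp add: h_def induced_tau_Affine)

lemma h_Ideal:
  "w1 \<noteq> 0 \<or> w2 \<noteq> 0 \<Longrightarrow> h a m k (Ideal_Point (cls w1 w2)) = Ideal_Point (cls w1 (w2 + m * w1))"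
  by (simp add: h_def induced_tau_Ideal)

lemma induced_tau: "induced_on_Pi \<beta> x (tau a m k s) = h a m k"
  by (rule C_map_eqI) (simp_all add: h_extensional induced_tau_Affine induced_tau_Ideal h_Affine h_Ideal,
    simp add: induced_on_Pi_def)

lemma h_eq_iff [simp]: "h a m k = h a' m' k' \<longleftrightarrow> a = a' \<and> m = m' \<and> k = k'"
proof
  assume eq: "h a m k = h a' m' k'"
  have "Affine_Point (pt (b + a) (c + m * b + k)) = Affine_Point (pt (b + a') (c + m' * b + k'))" for b c
    using h_Affine[of a m k b c] h_Affine[of a' m' k' b c] unfolding eq by simp
  then have "b + a = b + a'" "c + m * b + k = c + m' * b + k'" for b c by simp_all
  note this(1)[of 0] this(2)[of 0 0] this(2)[of 0 1]
  then show "a = a' \<and> m = m' \<and> k = k'" by simp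
qed simp

text \<open>This is the multiplication of a Heisenberg group: noncommutativity comes from the term
  \<open>m' * a\<close> alone, which is why the center will be given by
  \<open>a = m = 0\<close>.\<close>

lemma compose_h: "compose (pts C) (h a' m' k') (h a m k) = h (a + a') (m + m') (k + k' + m' * a)"
proof (rule C_map_eqI[OF compose_extensional h_extensional])
  fix b c
  show "compose (pts C) (h a' m' k') (h a m k) (Affine_Point (pt b c)) =
      h (a + a') (m + m') (k + k' + m' * a) (Affine_Point (pt b c))"
    by (simp add: compose_def h_Affine algebra_simps)
next
  fix w1 w2 :: 'a assume w: "w1 \<noteq> 0 \<or> w2 \<noteq> 0"
  then have "w1 \<noteq> 0 \<or> w2 + m * w1 \<noteq> 0" by auto
  with w show "compose (pts C) (h a' m' k') (h a m k) (Ideal_Point (cls w1 w2)) =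
      h (a + a') (m + m') (k + k' + m' * a) (Ideal_Point (cls w1 w2))"
    by (simp add: compose_def h_Ideal algebra_simps)
qed

lemma h_zero: "h 0 0 0 = (\<lambda>P\<in>pts C. P)"
  by (rule C_map_eqI[OF h_extensional]) (simp_all add: h_Affine h_Ideal)

lemma h_automorphism: "h a m k \<in> automorphisms C"
proof -
  let ?t = "tau a m k 0"
  have "bij_betw (image ?t) (pts (Pi_plane \<beta> x)) (pts (Pi_plane \<beta> x))"
  proof (rule bij_betw_finite_self)
    show "inj_on (image ?t) (pts (Pi_plane \<beta> x))"
      by (auto intro!: inj_onI simp: pts_Pi tau_pt)
  qed (auto simp: pts_Pi tau_pt)
  moreover have lns: "lns (Pi_plane \<beta> x) \<subseteq> PG_points" by (auto simp: lns_Pi ln_def)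
  have "bij_betw ?t (lns (Pi_plane \<beta> x)) (lns (Pi_plane \<beta> x))"
  proof (rule bij_betw_finite_self)
    show "inj_on ?t (lns (Pi_plane \<beta> x))" using inj_on_subset[OF tau_inj lns] .
    show "?t ` lns (Pi_plane \<beta> x) \<subseteq> lns (Pi_plane \<beta> x)"
    proof
      fix l assume "l \<in> ?t ` lns (Pi_plane \<beta> x)"
      then obtain w0 w1 w2 where "l = ?t (ln w0 w1 w2)" "w1 \<noteq> 0 \<or> w2 \<noteq> 0" unfolding lns_Pi by blast
      then show "l \<in> lns (Pi_plane \<beta> x)" using tau_ln ln_Pi[of w1 "w2 + m * w1"] by auto
    qed
  qed simp
  moreover have "inc (Pi_plane \<beta> x) (?t ` p) (?t l) \<longleftrightarrow> inc (Pi_plane \<beta> x) p l"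
    if p: "p \<in> pts (Pi_plane \<beta> x)" and l: "l \<in> lns (Pi_plane \<beta> x)" for p l
  proof -
    have "p \<subseteq> PG_points" using p by (auto simp: Pi_plane_def perp_def)
    then have "?t l \<in> ?t ` p \<longleftrightarrow> l \<in> p" by (rule inj_on_image_mem_iff[OF tau_inj subsetD[OF lns l]])
    then show ?thesis unfolding inc_Pi .
  qed
  ultimately show ?thesis
    unfolding h_def induced_on_Pi_def by (rule completion_automorphism)
qed


section \<open>Determination of the translations and the dual translations\<close>

lemma elation_C_eq_id:
  assumes "\<theta> \<in> elations C c a"
    and "Q \<in> pts C" "\<not> completion_inc (Pi_plane \<beta> x) Q a" "\<theta> Q = Q"
    and "m \<in> lns C" "completion_inc (Pi_plane \<beta> x) c m" "completion_inc (Pi_plane \<beta> x) Q m"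
    and "Q' \<in> pts C" "\<not> completion_inc (Pi_plane \<beta> x) Q' a" "\<not> completion_inc (Pi_plane \<beta> x) Q' m"
  shows "\<theta> = (\<lambda>P\<in>pts C. P)"
proof (rule elation_eq_id[where D = C and \<theta> = \<theta> and c = c and a = a and Q = Q and m = m and Q' = Q'])
  show "\<exists>m\<in>lns C. inc C p m \<and> inc C r m" if "p \<in> pts C" "r \<in> pts C" for p r
    using Pi.completion_line_through[OF that] unfolding inc_completion .
  show "\<exists>p\<in>pts C. inc C p m \<and> inc C p n" if "m \<in> lns C" "n \<in> lns C" for m n
    using Pi.completion_meet[OF that] unfolding inc_completion .
  show "m = n" if "p \<in> pts C" "r \<in> pts C" "p \<noteq> r" "m \<in> lns C" "n \<in> lns C"
    "inc C p m" "inc C r m" "inc C p n" "inc C r n" for p r m n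
    using Pi.completion_line_unique that unfolding inc_completion .
qed (use assms in \<open>simp_all only: inc_completion not_False_eq_True\<close>)

lemma h_inverse: "P \<in> pts C \<Longrightarrow> h a m k (h (- a) (- m) (m * a - k) P) = P"
  using compose_h[of a m k "- a" "- m" "m * a - k"] h_zero
  by (auto simp: compose_def fun_eq_iff dest!: spec[of _ P])

lemma eq_h_inverse:
  assumes "\<theta> \<in> automorphisms C" "compose (pts C) (h (- a) (- m) (m * a - k)) \<theta> = (\<lambda>P\<in>pts C. P)"
  shows "\<theta> = h a m k"
proof (rule extensionalityI[OF automorphismsD(1)[OF assms(1)] h_extensional])
  fix P assume P: "P \<in> pts C"
  have "h (- a) (- m) (m * a - k) (\<theta> P) = P"
    using fun_cong[OF assms(2), of P] P by (simp add: compose_def)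
  moreover have "\<theta> P \<in> pts C" by (rule automorphisms_mem[OF assms(1) P])
  ultimately show "\<theta> P = h a m k P"
    using h_inverse[of "\<theta> P" a m k] by simp
qed

text \<open>The hypothesis on \<open>a\<close> and \<open>k\<close> puts the displacement
  \<open>(a, k)\<close> in direction \<open>(w1, w2)\<close>, so lines through the center are
  preserved; with \<open>m = 0\<close> every direction is fixed, hence every point of the
  axis.\<close>

lemma h_translation:
  assumes w: "w1 \<noteq> 0 \<or> w2 \<noteq> 0" and ak: "a * w2 = k * w1"
  shows "h a 0 k \<in> elations C (Ideal_Point (cls w1 w2)) Infinity_Line"
proof -
  have fixed: "h a 0 k (Ideal_Point c) = Ideal_Point c" if c: "Ideal_Point c \<in> pts C" for c
    using c by (rule Ideal_cases) (simp add: h_Ideal)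
  have center: "completion_inc (Pi_plane \<beta> x) (h a 0 k P) m"
    if m: "m \<in> lns C" "completion_inc (Pi_plane \<beta> x) (Ideal_Point (cls w1 w2)) m"
      and P: "P \<in> pts C" "completion_inc (Pi_plane \<beta> x) P m" for m P
  using P(1) proof (cases rule: C_cases)
    case (1 b c)
    then obtain l where l: "m = Affine_Line l" "l \<in> pt b c" "l \<in> cls w1 w2" "l \<in> lns (Pi_plane \<beta> x)"
      using m P by (cases m) auto
    obtain v0 v1 v2 where v: "l = ln v0 v1 v2" "v1 \<noteq> 0 \<or> v2 \<noteq> 0" using l(4) by (rule lns_Pi_cases)
    have e: "w1 * v2 = w2 * v1" "v0 = b * v2 - c * v1"
      using l(2,3) v w by (simp_all add: ln_in_cls_iff ln_in_pt_iff)
    \<comment> \<open>Both \<open>(a, k)\<close> and \<open>(v1, v2)\<close> are multiples of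
      \<open>(w1, w2)\<close>; multiplying by \<open>w1\<close> when it is nonzero avoids naming the
      factors.\<close>
    have "a * v2 = k * v1"
    proof (cases "w1 = 0")
      case True
      then show ?thesis using e(1) ak w by auto
    next
      case False
      have "w1 * (a * v2) = (a * w2) * v1" using e(1) by (simp add: mult.left_commute mult.assoc)
      also have "\<dots> = w1 * (k * v1)" unfolding ak by (simp add: algebra_simps)
      finally show ?thesis using False by simp
    qed
    then have "l \<in> pt (b + a) (c + k)"
      unfolding v(1) ln_in_pt_iff[OF v(2)] e(2) by (simp add: algebra_simps)
    then show ?thesis unfolding 1 l(1) h_Affine by simp
  next
    case (2 v1 v2)
    then show ?thesis using fixed P by simp
  qed
  show ?thesis
    unfolding elations_def inc_completion
  proof (intro CollectI conjI ballI impI)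
    show "h a 0 k P = P" if "P \<in> pts C" "completion_inc (Pi_plane \<beta> x) P Infinity_Line" for P
      using that fixed by (cases P) simp_all
  qed (use w center in \<open>simp_all add: h_automorphism\<close>)
qed

text \<open>The map sends \<open>(b, c)\<close> to \<open>(b, c + m * (b - u))\<close>: it preserves
  each line of constant \<open>b\<close> and fixes the points of the line \<open>b = u\<close>,
  which is \<open>ln u 0 1\<close>. This explains the constant \<open>- (m * u)\<close>.\<close>

lemma h_dual_elation: "h 0 m (- (m * u)) \<in> elations C (Ideal_Point (cls 0 1)) (Affine_Line (ln u 0 1))"
proof -
  have ln01: "ln u 0 1 \<in> cls 0 1" by (simp add: ln_in_cls_iff)
  have center: "completion_inc (Pi_plane \<beta> x) (h 0 m (- (m * u)) P) n"
    if n: "n \<in> lns C" "completion_inc (Pi_plane \<beta> x) (Ideal_Point (cls 0 1)) n"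
      and P: "P \<in> pts C" "completion_inc (Pi_plane \<beta> x) P n" for n P
  using P(1) proof (cases rule: C_cases)
    case (1 b c)
    then obtain l where l: "n = Affine_Line l" "l \<in> pt b c" "l \<in> cls 0 1" "l \<in> lns (Pi_plane \<beta> x)"
      using n P by (cases n) auto
    obtain v0 v1 v2 where v: "l = ln v0 v1 v2" "v1 \<noteq> 0 \<or> v2 \<noteq> 0" using l(4) by (rule lns_Pi_cases)
    have "v1 = 0" "v0 = b * v2 - c * v1"
      using l(2,3) v by (simp_all add: ln_in_cls_iff ln_in_pt_iff)
    then show ?thesis unfolding 1 l(1) h_Affine using v by (simp add: ln_in_pt_iff)
  next
    case (2 w1 w2)
    show ?thesis
    proof (cases n)
      case (Affine_Line l)
      then have l: "l \<in> cls 0 1" "l \<in> cls w1 w2" "l \<in> lns (Pi_plane \<beta> x)" using n P 2 by auto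
      obtain v0 v1 v2 where v: "l = ln v0 v1 v2" "v1 \<noteq> 0 \<or> v2 \<noteq> 0" using l(3) by (rule lns_Pi_cases)
      have "v1 = 0" "w1 * v2 = w2 * v1" using l v 2(2) by (simp_all add: ln_in_cls_iff)
      then have "w1 = 0" using v(2) by simp
      then show ?thesis using P 2 by (simp add: h_Ideal)
    next
      case Infinity_Line
      then show ?thesis using 2 by (simp add: h_Ideal)
    qed
  qed
  have axis: "h 0 m (- (m * u)) P = P"
    if P: "P \<in> pts C" "completion_inc (Pi_plane \<beta> x) P (Affine_Line (ln u 0 1))" for P
  using P(1) proof (cases rule: C_cases)
    case (1 b c)
    then show ?thesis using P(2) by (simp add: ln_in_pt_iff h_Affine)
  next
    case (2 w1 w2)
    then have "w1 = 0" using P(2) by (simp add: ln_in_cls_iff)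
    then show ?thesis using 2 by (simp add: h_Ideal)
  qed
  show ?thesis
    unfolding elations_def inc_completion
    by (intro CollectI conjI ballI impI) (use ln01 axis center in \<open>simp_all add: h_automorphism ln_Pi\<close>)
qed

text \<open>An elation cannot move an affine point to an ideal one on a line through the center, since the
  only ideal point of such a line is the center itself.\<close>

lemma elation_Affine:
  assumes \<theta>: "\<theta> \<in> elations C (Ideal_Point (cls w1 w2)) A" and w: "w1 \<noteq> 0 \<or> w2 \<noteq> 0"
    and l: "ln v0 w1 w2 \<in> pt b c"
  obtains b' c' where "\<theta> (Affine_Point (pt b c)) = Affine_Point (pt b' c')" "ln v0 w1 w2 \<in> pt b' c'"
proof -
  have aut: "\<theta> \<in> automorphisms C" and A: "A \<in> lns C" "completion_inc (Pi_plane \<beta> x) (Ideal_Point (cls w1 w2)) A"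
    using \<theta> by (simp_all add: elations_def)
  have fixed: "\<theta> (Ideal_Point (cls w1 w2)) = Ideal_Point (cls w1 w2)"
    using \<theta> w by (simp add: elations_def)
  let ?L = "Affine_Line (ln v0 w1 w2)"
  have L: "?L \<in> lns C" "completion_inc (Pi_plane \<beta> x) (Ideal_Point (cls w1 w2)) ?L"
    using w by (simp_all add: ln_Pi ln_in_cls_iff)
  have pC: "Affine_Point (pt b c) \<in> pts C" by simp
  have on: "completion_inc (Pi_plane \<beta> x) (\<theta> (Affine_Point (pt b c))) ?L"
    using \<theta> L pC l unfolding elations_def inc_completion by simp
  have "\<theta> (Affine_Point (pt b c)) \<in> pts C" by (rule automorphisms_mem[OF aut pC])
  then show thesis
  proof (cases rule: C_cases)
    case (1 b' c')
    then show ?thesis using that on by simp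
  next
    case (2 u1 u2)
    then have "ln v0 w1 w2 \<in> cls u1 u2" using on by simp
    then have "cls u1 u2 = cls w1 w2"
      using cls_eq_iff[OF 2(2) w] w 2(2) by (simp add: ln_in_cls_iff)
    then have "\<theta> (Affine_Point (pt b c)) = \<theta> (Ideal_Point (cls w1 w2))" using 2(1) fixed by simp
    then have "Affine_Point (pt b c) = (Ideal_Point (cls w1 w2) :: ('a pg_set, 'a pg_point) cpoint)"
      using inj_onD[OF bij_betw_imp_inj_on[OF automorphismsD(2)[OF aut]] _ pC Ideal_cls[OF w]] by blast
    then show ?thesis by simp
  qed
qed

text \<open>The image \<open>(a, k)\<close> of the origin settles everything: dividing by the
  explicit translation with the same image leaves an elation that fixes the origin.\<close>

lemma elations_Infinity_Line:
  assumes w: "w1 \<noteq> 0 \<or> w2 \<noteq> 0"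
  shows "elations C (Ideal_Point (cls w1 w2)) Infinity_Line = {h a 0 k | a k. a * w2 = k * w1}"
proof
  show "{h a 0 k | a k. a * w2 = k * w1} \<subseteq> elations C (Ideal_Point (cls w1 w2)) Infinity_Line"
    using h_translation[OF w] by blast
  show "elations C (Ideal_Point (cls w1 w2)) Infinity_Line \<subseteq> {h a 0 k | a k. a * w2 = k * w1}"
  proof
    fix \<theta> assume \<theta>: "\<theta> \<in> elations C (Ideal_Point (cls w1 w2)) Infinity_Line"
    have "ln 0 w1 w2 \<in> pt 0 0" using w by (simp add: ln_in_pt_iff)
    from elation_Affine[OF \<theta> w this] obtain a k
      where ak: "\<theta> (Affine_Point (pt 0 0)) = Affine_Point (pt a k)" "ln 0 w1 w2 \<in> pt a k" by blast
    have e: "a * w2 = k * w1" using ak(2) w by (simp add: ln_in_pt_iff)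
    \<comment> \<open>The terms \<open>- 0\<close> and \<open>0 * a - k\<close> are the parameters
      of the inverse of \<open>h a 0 k\<close> in the shape that \<open>eq_h_inverse\<close>
      expects.\<close>
    define g where "g = compose (pts C) (h (- a) (- 0) (0 * a - k)) \<theta>"
    have g: "g \<in> elations C (Ideal_Point (cls w1 w2)) Infinity_Line"
      unfolding g_def by (rule compose_elations[OF _ \<theta>]) (use h_translation[OF w, of "- a" "- k"] e in simp)
    \<comment> \<open>A point off the line through the origin with direction
      \<open>(w1, w2)\<close>, to serve as \<open>Q'\<close>.\<close>
    define b c :: 'a where "b = (if w2 \<noteq> 0 then 1 else 0)" and "c = (if w2 \<noteq> 0 then 0 else 1)"
    have bc: "b * w2 - c * w1 \<noteq> 0" using w by (auto simp: b_def c_def)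
    have "g = (\<lambda>P\<in>pts C. P)"
    proof (rule elation_C_eq_id[OF g, where Q = "Affine_Point (pt 0 0)" and m = "Affine_Line (ln 0 w1 w2)"
          and Q' = "Affine_Point (pt b c)"])
      show "g (Affine_Point (pt 0 0)) = Affine_Point (pt 0 0)"
        by (simp add: g_def compose_def ak(1) h_Affine)
      show "\<not> completion_inc (Pi_plane \<beta> x) (Affine_Point (pt b c)) (Affine_Line (ln 0 w1 w2))"
        using bc w by (simp add: ln_in_pt_iff)
    qed (use w in \<open>simp_all add: ln_in_pt_iff ln_in_cls_iff ln_Pi\<close>)
    then have "\<theta> = h a 0 k"
      unfolding g_def using \<theta> by (intro eq_h_inverse) (simp_all add: elations_def)
    then show "\<theta> \<in> {h a 0 k | a k. a * w2 = k * w1}" using e by blast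
  qed
qed

lemma elations_affine_axis:
  "elations C (Ideal_Point (cls 0 1)) (Affine_Line (ln u 0 1)) \<subseteq> {h 0 m k | m k. True}"
proof
  fix \<theta> assume \<theta>: "\<theta> \<in> elations C (Ideal_Point (cls 0 1)) (Affine_Line (ln u 0 1))"
  have w: "(0::'a) \<noteq> 0 \<or> (1::'a) \<noteq> 0" by simp
  \<comment> \<open>The base point has \<open>b = u + 1\<close>, off the axis \<open>b = u\<close>,
    and there the dual elation shifts \<open>c\<close> by \<open>m * (u + 1 - u) = m\<close>.
    Starting from \<open>c = 0\<close>, the parameter \<open>m\<close> is thus the new second
    coordinate.\<close>
  have "ln (u + 1) 0 1 \<in> pt (u + 1) 0" by (simp add: ln_in_pt_iff)
  from elation_Affine[OF \<theta> w this] obtain b m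
    where "\<theta> (Affine_Point (pt (u + 1) 0)) = Affine_Point (pt b m)" "ln (u + 1) 0 1 \<in> pt b m" by blast
  then have m: "\<theta> (Affine_Point (pt (u + 1) 0)) = Affine_Point (pt (u + 1) m)"
    by (simp add: ln_in_pt_iff)
  define g where "g = compose (pts C) (h (- 0) (- m) (m * 0 - - (m * u))) \<theta>"
  have g: "g \<in> elations C (Ideal_Point (cls 0 1)) (Affine_Line (ln u 0 1))"
    unfolding g_def by (rule compose_elations[OF _ \<theta>]) (use h_dual_elation[of "- m" u] in simp)
  \<comment> \<open>The ideal point \<open>cls 1 0\<close> has a direction other than that of the
    center, so it lies neither on the axis nor on the line joining \<open>Q\<close> to the
    center.\<close>
  have "g = (\<lambda>P\<in>pts C. P)"
  proof (rule elation_C_eq_id[OF g, where Q = "Affine_Point (pt (u + 1) 0)" and m = "Affine_Line (ln (u + 1) 0 1)"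
        and Q' = "Ideal_Point (cls 1 0)"])
    show "g (Affine_Point (pt (u + 1) 0)) = Affine_Point (pt (u + 1) 0)"
      by (simp add: g_def compose_def m h_Affine) (simp add: algebra_simps)
  qed (simp_all add: ln_in_pt_iff ln_in_cls_iff ln_Pi)
  then have "\<theta> = h 0 m (- (m * u))"
    unfolding g_def using \<theta> by (intro eq_h_inverse) (simp_all add: elations_def)
  then show "\<theta> \<in> {h 0 m k | m k. True}" by blast
qed

lemma translation_group_eq: "translation_group \<beta> x = {h a 0 k | a k. True}"
proof
  show "translation_group \<beta> x \<subseteq> {h a 0 k | a k. True}"
  proof
    fix \<theta> assume "\<theta> \<in> translation_group \<beta> x"
    then obtain c where c: "\<theta> \<in> elations C c Infinity_Line"
      unfolding translation_group_def elations_with_axis_def by blast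
    then have "c \<in> pts C" "completion_inc (Pi_plane \<beta> x) c Infinity_Line" by (simp_all add: elations_def)
    then obtain d where d: "c = Ideal_Point d" by (cases c) simp_all
    then have "Ideal_Point d \<in> pts C" using \<open>c \<in> pts C\<close> by simp
    then obtain w1 w2 where w: "d = cls w1 w2" "w1 \<noteq> 0 \<or> w2 \<noteq> 0" by (rule Ideal_cases)
    show "\<theta> \<in> {h a 0 k | a k. True}"
      using c unfolding d w(1) elations_Infinity_Line[OF w(2)] by blast
  qed
  show "{h a 0 k | a k. True} \<subseteq> translation_group \<beta> x"
  proof
    fix \<theta> assume "\<theta> \<in> {h a 0 k | a k. True}"
    then obtain a k where ak: "\<theta> = h a 0 k" by blast
    \<comment> \<open>The displacement itself serves as direction. For the identity any center will
      do, here that of direction \<open>(1, 1)\<close>.\<close>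
    have "\<exists>w1 w2. (w1 \<noteq> 0 \<or> w2 \<noteq> 0) \<and> a * w2 = k * w1"
    proof (cases "a = 0 \<and> k = 0")
      case True
      then show ?thesis by (intro exI[of _ 1]) simp
    next
      case False
      then show ?thesis by (intro exI[of _ a] exI[of _ k]) (auto simp: mult.commute)
    qed
    then obtain w1 w2 where "w1 \<noteq> 0 \<or> w2 \<noteq> 0" "a * w2 = k * w1" by blast
    then have "\<theta> \<in> elations C (Ideal_Point (cls w1 w2)) Infinity_Line"
      unfolding ak by (rule h_translation)
    then show "\<theta> \<in> translation_group \<beta> x"
      unfolding translation_group_def elations_with_axis_def by blast
  qed
qed

lemma dual_translation_group_eq: "dual_translation_group \<beta> x (Ideal_Point (cls 0 1)) = {h 0 m k | m k. True}"
proof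
  have w: "(0::'a) \<noteq> 0 \<or> (1::'a) \<noteq> 0" by simp
  show "dual_translation_group \<beta> x (Ideal_Point (cls 0 1)) \<subseteq> {h 0 m k | m k. True}"
  proof
    fix \<theta> assume "\<theta> \<in> dual_translation_group \<beta> x (Ideal_Point (cls 0 1))"
    then obtain A where A: "\<theta> \<in> elations C (Ideal_Point (cls 0 1)) A"
      unfolding dual_translation_group_def elations_with_center_def by blast
    then have Al: "A \<in> lns C" "completion_inc (Pi_plane \<beta> x) (Ideal_Point (cls 0 1)) A"
      by (simp_all add: elations_def)
    show "\<theta> \<in> {h 0 m k | m k. True}"
    proof (cases A)
      case (Affine_Line l)
      then have l: "l \<in> lns (Pi_plane \<beta> x)" "l \<in> cls 0 1" using Al by simp_all
      obtain v0 v1 v2 where v: "l = ln v0 v1 v2" "v1 \<noteq> 0 \<or> v2 \<noteq> 0" using l(1) by (rule lns_Pi_cases)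
      have v1: "v1 = 0" using l(2) v by (simp add: ln_in_cls_iff)
      \<comment> \<open>As \<open>v1 = 0\<close>, the line is \<open>b = v0 / v2\<close>; rescaling
        brings it to the form treated by \<open>elations_affine_axis\<close>.\<close>
      have "l = ln (v0 / v2) 0 1"
        unfolding v(1) ln_eq_iff[OF v(2)] using v(2) v1 by (intro exI[of _ "1 / v2"]) simp
      then show ?thesis using A Affine_Line elations_affine_axis by blast
    next
      case Infinity_Line
      then show ?thesis using A unfolding Infinity_Line elations_Infinity_Line[OF w] by auto
    qed
  qed
  show "{h 0 m k | m k. True} \<subseteq> dual_translation_group \<beta> x (Ideal_Point (cls 0 1))"
  proof
    fix \<theta> assume "\<theta> \<in> {h 0 m k | m k. True}"
    then obtain m k where mk: "\<theta> = h 0 m k" by blast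
    \<comment> \<open>For \<open>m\<close> nonzero an affine point is fixed when
      \<open>m * b + k = 0\<close>, so the axis is \<open>b = - k / m\<close>; for
      \<open>m = 0\<close> the map is a translation with center \<ell>.\<close>
    have "\<theta> \<in> elations C (Ideal_Point (cls 0 1)) (if m = 0 then Infinity_Line else Affine_Line (ln (- k / m) 0 1))"
    proof (cases "m = 0")
      case True
      then show ?thesis unfolding mk using h_translation[OF w, of 0 k] by simp
    next
      case False
      then show ?thesis unfolding mk using h_dual_elation[of m "- k / m"] by simp
    qed
    then show "\<theta> \<in> dual_translation_group \<beta> x (Ideal_Point (cls 0 1))"
      unfolding dual_translation_group_def elations_with_center_def by blast
  qed
qed

section \<open>The group H(\<ell>), its center and its quotient\<close>

abbreviation H :: "'a cpoint_map monoid" where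
  "H \<equiv> H_group \<beta> x (Ideal_Point (cls 0 1))"

lemma mult_H [simp]: "h a' m' k' \<otimes>\<^bsub>H\<^esub> h a m k = h (a + a') (m + m') (k + k' + m' * a)"
  using mult_aut_group[OF h_automorphism h_automorphism, of a' m' k' a m k]
  by (simp add: H_group_def compose_h)

lemma carrier_H: "carrier H = {h a m k | a m k. True}"
proof -
  interpret A: group "aut_group C" by (rule group_aut_group)
  let ?S = "translation_group \<beta> x \<union> dual_translation_group \<beta> x (Ideal_Point (cls 0 1))"
  have carrier: "carrier H = generate (aut_group C) ?S"
    by (simp add: H_group_def)
  have S: "h a 0 k \<in> ?S" "h 0 m k \<in> ?S" for a m k
    by (auto simp: translation_group_eq dual_translation_group_eq)
  have mult: "h a' m' k' \<otimes>\<^bsub>aut_group C\<^esub> h a m k = h (a + a') (m + m') (k + k' + m' * a)" for a m k a' m' k'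
    using mult_aut_group[OF h_automorphism h_automorphism] by (simp add: compose_h)
  have inv: "inv\<^bsub>aut_group C\<^esub> h a m k = h (- a) (- m) (m * a - k)" for a m k
    by (rule A.inv_equality) (simp_all add: mult h_automorphism flip: h_zero)
  show ?thesis
  proof
    show "carrier H \<subseteq> {h a m k | a m k. True}"
    proof
      fix \<theta> assume "\<theta> \<in> carrier H"
      then have "\<theta> \<in> generate (aut_group C) ?S" unfolding carrier .
      then show "\<theta> \<in> {h a m k | a m k. True}"
      proof induction
        case one
        then show ?case unfolding one_aut_group h_zero[symmetric] by blast
      next
        case (incl g)
        then show ?case unfolding translation_group_eq dual_translation_group_eq by blast
      next
        case (inv g)
        then obtain a m k where "g = h a m k"
          unfolding translation_group_eq dual_translation_group_eq by blast
        then show ?case using \<open>\<And>a m k. inv\<^bsub>aut_group C\<^esub> h a m k = _ a m k\<close> by blast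
      next
        case (eng g1 g2)
        then obtain a' m' k' a m k where "g1 = h a' m' k'" "g2 = h a m k" by auto
        then show ?case unfolding mult[symmetric] by (auto simp: mult)
      qed
    qed
    show "{h a m k | a m k. True} \<subseteq> carrier H"
    proof
      fix \<theta> assume "\<theta> \<in> {h a m k | a m k. True}"
      then obtain a m k where "\<theta> = h a m k" by blast
      \<comment> \<open>A translation followed by a dual translation; the summand
        \<open>- m * a\<close> cancels the mixed term of the product.\<close>
      then have "\<theta> = h 0 m (k - m * a) \<otimes>\<^bsub>aut_group C\<^esub> h a 0 0" by (simp add: mult)
      then show "\<theta> \<in> carrier H"
        unfolding carrier using generate.eng generate.incl S by metis
    qed
  qed
qed

lemma h_H [simp]: "h a m k \<in> carrier H"
  unfolding carrier_H by blast

text \<open>These are the cosets of the center. Forgetting \<open>k\<close> turns the quotient into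
  the additive group of pairs \<open>(a, m)\<close>.\<close>

definition Cos :: "'a \<Rightarrow> 'a \<Rightarrow> 'a cpoint_map set" where
  "Cos a m = {h a m k | k. True}"

lemma h_Cos [simp]: "h a m k \<in> Cos a' m' \<longleftrightarrow> a = a' \<and> m = m'"
  by (auto simp: Cos_def)

lemma Cos_eq_iff [simp]: "Cos a m = Cos a' m' \<longleftrightarrow> a = a' \<and> m = m'"
proof
  assume "Cos a m = Cos a' m'"
  then have "h a m 0 \<in> Cos a' m'" using h_Cos[of a m 0 a m] by simp
  then show "a = a' \<and> m = m'" by simp
qed simp

lemma group_center_H: "group_center H = Cos 0 0"
proof
  show "group_center H \<subseteq> Cos 0 0"
  proof
    fix z assume z: "z \<in> group_center H"
    then obtain a m k where amk: "z = h a m k" by (auto simp: group_center_def carrier_H)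
    \<comment> \<open>Commuting with \<open>h 1 0 0\<close> forces \<open>m = 0\<close>, and
      commuting with \<open>h 0 1 0\<close> forces \<open>a = 0\<close>.\<close>
    have "z \<otimes>\<^bsub>H\<^esub> h 1 0 0 = h 1 0 0 \<otimes>\<^bsub>H\<^esub> z" "z \<otimes>\<^bsub>H\<^esub> h 0 1 0 = h 0 1 0 \<otimes>\<^bsub>H\<^esub> z"
      using z by (simp_all add: group_center_def)
    then show "z \<in> Cos 0 0" unfolding amk by simp
  qed
  show "Cos 0 0 \<subseteq> group_center H"
    by (auto simp: Cos_def group_center_def carrier_H add.commute)
qed

lemma Cos_r_coset: "Cos 0 0 #>\<^bsub>H\<^esub> h a m k = Cos a m"
proof
  show "Cos 0 0 #>\<^bsub>H\<^esub> h a m k \<subseteq> Cos a m"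
    by (auto simp: r_coset_def Cos_def[of 0 0])
  show "Cos a m \<subseteq> Cos 0 0 #>\<^bsub>H\<^esub> h a m k"
  proof
    fix g assume "g \<in> Cos a m"
    then obtain k' where "g = h a m k'" by (auto simp: Cos_def)
    then have "g = h 0 0 (k' - k) \<otimes>\<^bsub>H\<^esub> h a m k" by simp
    moreover have "h 0 0 (k' - k) \<in> Cos 0 0" by simp
    ultimately show "g \<in> Cos 0 0 #>\<^bsub>H\<^esub> h a m k" unfolding r_coset_def by blast
  qed
qed

abbreviation HZ :: "'a cpoint_map set monoid" where
  "HZ \<equiv> H_mod_center \<beta> x (Ideal_Point (cls 0 1))"

lemma one_HZ: "\<one>\<^bsub>HZ\<^esub> = Cos 0 0"
  by (simp add: H_mod_center_def FactGroup_def group_center_H)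

lemma carrier_HZ: "carrier HZ = {Cos a m | a m. True}"
proof -
  have "carrier HZ = (\<Union>g\<in>carrier H. {Cos 0 0 #>\<^bsub>H\<^esub> g})"
    by (simp add: H_mod_center_def FactGroup_def group_center_H RCOSETS_def)
  also have "\<dots> = {Cos a m | a m. True}"
    unfolding carrier_H using Cos_r_coset by fast
  finally show ?thesis .
qed

lemma mult_HZ: "Cos a' m' \<otimes>\<^bsub>HZ\<^esub> Cos a m = Cos (a + a') (m + m')"
proof -
  have "Cos a' m' \<otimes>\<^bsub>HZ\<^esub> Cos a m = {g' \<otimes>\<^bsub>H\<^esub> g | g' g. g' \<in> Cos a' m' \<and> g \<in> Cos a m}"
    by (auto simp: H_mod_center_def FactGroup_def set_mult_def)
  also have "\<dots> = Cos (a + a') (m + m')"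
  proof
    show "{g' \<otimes>\<^bsub>H\<^esub> g | g' g. g' \<in> Cos a' m' \<and> g \<in> Cos a m} \<subseteq> Cos (a + a') (m + m')"
      by (auto simp: Cos_def[of a' m'] Cos_def[of a m])
    show "Cos (a + a') (m + m') \<subseteq> {g' \<otimes>\<^bsub>H\<^esub> g | g' g. g' \<in> Cos a' m' \<and> g \<in> Cos a m}"
    proof
      fix g assume "g \<in> Cos (a + a') (m + m')"
      then obtain k where "g = h (a + a') (m + m') k" by (auto simp: Cos_def)
      then have "g = h a' m' (k - m' * a) \<otimes>\<^bsub>H\<^esub> h a m 0" by simp
      then show "g \<in> {g' \<otimes>\<^bsub>H\<^esub> g | g' g. g' \<in> Cos a' m' \<and> g \<in> Cos a m}"
        using h_Cos by blast
    qed
  qed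
  finally show ?thesis .
qed

lemma B_mod_center_eq: "B_mod_center \<beta> x (Ideal_Point (cls 0 1)) = {Cos 0 m | m. True}"
  unfolding B_mod_center_def dual_translation_group_eq group_center_H using Cos_r_coset by fast

text \<open>\<open>K\<close> is an additive group of pairs. Trivial intersection with the image of
  \<open>B\<close>, the pairs with \<open>a = 0\<close>, makes the first projection injective on
  \<open>S\<close>, and order \<open>q\<close> makes it onto; so \<open>S\<close> is the graph of an
  additive map.\<close>

lemma BB_cases:
  assumes K: "K \<in> BB \<beta> x (Ideal_Point (cls 0 1))"
  obtains S where "K = {Cos a m | a m. (a, m) \<in> S}" "(0, 0) \<in> S"
    "\<And>a m a' m'. (a, m) \<in> S \<Longrightarrow> (a', m') \<in> S \<Longrightarrow> (a + a', m + m') \<in> S"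
    "\<And>a m. (a, m) \<in> S \<Longrightarrow> (- a, - m) \<in> S"
    "\<And>a. \<exists>!m. (a, m) \<in> S"
proof -
  define S where "S = {(a, m). Cos a m \<in> K}"
  have sub: "subgroup K HZ" and card: "card K = CARD('a)"
    and B: "K \<inter> {Cos 0 m | m. True} = {Cos 0 0}"
    using K by (simp_all add: BB_def B_mod_center_eq one_HZ)
  have "K \<subseteq> {Cos a m | a m. True}" using subgroup.subset[OF sub] by (simp add: carrier_HZ)
  then have KS: "K = {Cos a m | a m. (a, m) \<in> S}" unfolding S_def by blast
  have zero: "(0, 0) \<in> S" using subgroup.one_closed[OF sub] by (simp add: S_def one_HZ)
  have add: "(a + a', m + m') \<in> S" if "(a, m) \<in> S" "(a', m') \<in> S" for a m a' m'
    using subgroup.m_closed[OF sub, of "Cos a' m'" "Cos a m"] that by (simp add: S_def mult_HZ)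
  have neg: "(- a, - m) \<in> S" if am: "(a, m) \<in> S" for a m
  proof -
    \<comment> \<open>Negatives come from finiteness: adding \<open>(a, m)\<close> permutes
      \<open>S\<close>, so some element is sent to \<open>(0, 0)\<close>.\<close>
    let ?f = "\<lambda>p. (a + fst p, m + snd p)"
    have "?f ` S \<subseteq> S" using add[OF am] by auto
    moreover have "inj_on ?f S" by (auto intro!: inj_onI prod_eqI)
    ultimately have "?f ` S = S" using endo_inj_surj[of S ?f] by simp
    then obtain p where p: "p \<in> S" "?f p = (0, 0)" using zero by (metis (no_types, lifting) imageE)
    then have "p = (- a, - m)" by (simp add: prod_eq_iff eq_neg_iff_add_eq_0 add.commute)
    then show ?thesis using p(1) by simp
  qed
  have kernel: "m = 0" if "(0, m) \<in> S" for m
  proof -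
    have "Cos 0 m \<in> K \<inter> {Cos 0 m | m. True}" using that by (auto simp: S_def)
    then show ?thesis unfolding B by simp
  qed
  have unique: "m = m'" if "(a, m) \<in> S" "(a, m') \<in> S" for a m m'
    using kernel[of "m + - m'"] add[OF that(1) neg[OF that(2)]] by simp
  have "inj_on fst S" using unique by (auto intro!: inj_onI)
  then have "card (fst ` S) = card S" by (rule card_image)
  also have "card S = card K"
  proof -
    have "K = (\<lambda>(a, m). Cos a m) ` S" unfolding KS by auto
    moreover have "inj_on (\<lambda>(a, m). Cos a m) S" by (auto intro!: inj_onI)
    ultimately show ?thesis by (simp add: card_image)
  qed
  finally have "fst ` S = UNIV" using card by (intro card_subset_eq) auto
  then have "\<exists>m. (a, m) \<in> S" for a by (metis UNIV_I imageE prod.collapse)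
  then show thesis using that[OF KS zero add neg] unique by blast
qed

section \<open>Automorphisms acting trivially on \<open>\<Pi>(x)\<close>\<close>

lemma pt_subset_lns: "pt b c \<subseteq> lns (Pi_plane \<beta> x)"
  unfolding pt_def lns_Pi by blast

text \<open>Fixing every line of \<Pi>(x) means fixing every point of it, so \<open>\<psi>\<close>
  can only permute the points of P(q) above a given \<open>pt b c\<close>.\<close>

lemma fixes_Pi_aff:
  assumes \<psi>: "\<psi> \<in> automorphisms (W \<beta>)" "\<psi> x = x"
    and fixed: "\<And>y. y \<in> lns (Pi_plane \<beta> x) \<Longrightarrow> \<psi> y = y"
  obtains z' where "\<psi> (aff z b c) = aff z' b c"
proof -
  have "\<psi> (aff z b c) \<in> PG_points"
    using automorphisms_mem[OF \<psi>(1), of "aff z b c"] by simp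
  moreover have "\<not> collinear_pts (W \<beta>) x (\<psi> (aff z b c))"
    using automorphism_collinear_iff[OF \<psi>(1), of x "aff z b c"] \<psi>(2) by simp
  ultimately obtain z' b' c' where z': "\<psi> (aff z b c) = aff z' b' c'"
    by (rule not_collinear_x_cases)
  have "\<psi> ` pt b c = perp (W \<beta>) (\<psi> ` {x, aff z b c})"
    using automorphism_perp[OF \<psi>(1), of "{x, aff z b c}"] by (simp add: perp_x_aff)
  also have "\<dots> = pt b' c'" by (simp add: \<psi>(2) z' perp_x_aff)
  finally have "\<psi> ` pt b c = pt b' c'" .
  moreover have "\<psi> ` pt b c = pt b c"
    using fixed pt_subset_lns by (force simp: subset_iff)
  ultimately have "b' = b" "c' = c" by simp_all
  then show ?thesis using that z' by blast
qed

text \<open>Fixed points propagate: above \<open>pt b' c'\<close> exactly one point is collinear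
  with a given \<open>aff z b c\<close>, so if the latter is fixed then so is the former. Such steps
  lead from the base point to every point off the perp of \<open>x\<close>.\<close>

lemma fixes_Pi_eq_id:
  assumes \<psi>: "\<psi> \<in> automorphisms (W \<beta>)" "\<psi> x = x"
    and fixed: "\<And>y. y \<in> lns (Pi_plane \<beta> x) \<Longrightarrow> \<psi> y = y"
    and base: "\<psi> (aff 0 0 0) = aff 0 0 0"
    and P: "P \<in> PG_points"
  shows "\<psi> P = P"
proof -
  have step: "\<psi> (aff y b' c') = aff y b' c'"
    if z: "\<psi> (aff z b c) = aff z b c" and eq: "z - y + b * c' - c * b' = 0" for z b c y b' c'
  proof -
    obtain y' where y': "\<psi> (aff y b' c') = aff y' b' c'" using \<psi> fixed by (rule fixes_Pi_aff)
    have "collinear_pts (W \<beta>) (aff z b c) (aff y b' c')"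
      unfolding aff_def using eq by (subst collinear_pp) simp_all
    then have "collinear_pts (W \<beta>) (aff z b c) (aff y' b' c')"
      using automorphism_collinear_iff[OF \<psi>(1), of "aff z b c" "aff y b' c'"] z y' by simp
    then have "z - y' + b * c' - c * b' = 0"
      unfolding aff_def by (subst (asm) collinear_pp) simp_all
    then have "y' = y" using eq by (simp add: algebra_simps)
    then show ?thesis using y' by simp
  qed
  have two: "\<psi> (aff y b c) = aff y b c" if bc: "b \<noteq> 0 \<or> c \<noteq> 0" for y b c
  proof -
    \<comment> \<open>The intermediate point \<open>aff 0 b1 c1\<close> is always collinear with the
      base point. Its collinearity with \<open>aff y b c\<close> is the stated equation, solvable
      because \<open>(b, c)\<close> is nonzero.\<close>
    obtain b1 c1 where e: "b1 * c - c1 * b = y"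
    proof (cases "c = 0")
      case True
      then show ?thesis using bc that[of 0 "- y / b"] by simp
    next
      case False
      then show ?thesis using that[of "y / c" 0] by simp
    qed
    have "\<psi> (aff 0 b1 c1) = aff 0 b1 c1" by (rule step[OF base]) simp
    then show ?thesis by (rule step) (simp flip: e)
  qed
  have aff: "\<psi> (aff y b c) = aff y b c" for y b c
  proof (cases "b = 0 \<and> c = 0")
    case True
    \<comment> \<open>For \<open>b = c = 0\<close> that equation would give only
      \<open>y = 0\<close>; but \<open>aff y 0 0\<close> is collinear with \<open>aff y 1 0\<close>,
      already known to be fixed.\<close>
    have "\<psi> (aff y 1 0) = aff y 1 0" by (rule two) simp
    then show ?thesis by (rule step) (use True in simp)
  next
    case False
    then show ?thesis by (intro two) simp
  qed
  obtain a b c d where abcd: "P = pp a b c d" "a \<noteq> 0 \<or> b \<noteq> 0 \<or> c \<noteq> 0 \<or> d \<noteq> 0"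
    using P by (rule PG_cases)
  show ?thesis
  proof (cases "d = 0")
    case False
    then have "\<not> collinear_pts (W \<beta>) x P" using abcd collinear_x_pp by blast
    with P obtain z b' c' where "P = aff z b' c'" by (rule not_collinear_x_cases)
    then show ?thesis using aff by simp
  next
    case d: True
    show ?thesis
    proof (cases "b = 0 \<and> c = 0")
      case True
      then have "P = x" using abcd d ln_zero_zero[of a] by (simp add: ln_def)
      then show ?thesis using \<psi>(2) by simp
    next
      case False
      then have "P \<in> lns (Pi_plane \<beta> x)" using abcd(1) d ln_Pi[of b c a] by (simp add: ln_def)
      then show ?thesis by (rule fixed)
    qed
  qed
qed

text \<open>A line of \<Pi>(x) is determined by two of its points, and the images of points are
  known from \<open>ind\<close>.\<close>

lemma induced_h_eq_tau_on_lines: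
  assumes ind: "induced_on_Pi \<beta> x \<theta> = h a m k" and y: "y \<in> lns (Pi_plane \<beta> x)"
  shows "\<theta> y = tau a m k 0 y"
proof -
  have pt: "\<theta> ` pt b c = pt (b + a) (c + m * b + k)" for b c
  proof -
    have "induced_on_Pi \<beta> x \<theta> (Affine_Point (pt b c)) = Affine_Point (\<theta> ` pt b c)"
      by (simp add: induced_on_Pi_def)
    then show ?thesis unfolding ind h_Affine by simp
  qed
  obtain w0 w1 w2 where w: "y = ln w0 w1 w2" "w1 \<noteq> 0 \<or> w2 \<noteq> 0" using y by (rule lns_Pi_cases)
  \<comment> \<open>One point of the line, taken with a coordinate zero; displacing it by the
    direction \<open>(w1, w2)\<close> gives a second.\<close>
  obtain b c where bc: "w0 = b * w2 - c * w1"
  proof (cases "w2 = 0")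
    case True
    then show ?thesis using w(2) that[of 0 "- w0 / w1"] by simp
  next
    case False
    then show ?thesis using that[of "w0 / w2" 0] by simp
  qed
  have "y \<in> pt b c" "y \<in> pt (b + w1) (c + w2)"
    unfolding w(1) ln_in_pt_iff[OF w(2)] by (simp_all add: bc algebra_simps)
  then have mem: "\<theta> y \<in> \<theta> ` pt b c" "\<theta> y \<in> \<theta> ` pt (b + w1) (c + w2)"
    "tau a m k 0 y \<in> tau a m k 0 ` pt b c" "tau a m k 0 y \<in> tau a m k 0 ` pt (b + w1) (c + w2)"
    by simp_all
  note mem = mem[unfolded pt tau_pt]
  show ?thesis
  proof (rule Pi.line_unique)
    show "pt (b + a) (c + m * b + k) \<noteq> pt (b + w1 + a) (c + w2 + m * (b + w1) + k)"
      using w(2) by (auto simp: algebra_simps)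
  qed (use mem pt_subset_lns in auto)
qed

text \<open>Dividing by \<open>tau a m k 0\<close> leaves an automorphism acting trivially on
  \<Pi>(x). It moves \<open>aff 0 0 0\<close> to some \<open>aff z 0 0\<close>, and the transvection
  with parameter \<open>- z\<close> brings this point back, so that \<open>fixes_Pi_eq_id\<close>
  applies; hence \<open>s = z\<close>.\<close>

lemma induced_h_imp_tau:
  assumes \<theta>: "\<theta> \<in> automorphisms (W \<beta>)" "\<theta> x = x" and ind: "induced_on_Pi \<beta> x \<theta> = h a m k"
  shows "\<exists>s. \<theta> = tau a m k s"
proof -
  let ?inv = "tau (- a) (- m) (m * a - k) (- 0)"
  have lPG: "y \<in> PG_points" if "y \<in> lns (Pi_plane \<beta> x)" for y
    using that by (auto simp: lns_Pi ln_def)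
  have mem: "\<theta> P \<in> PG_points" if "P \<in> PG_points" for P
    using automorphisms_mem[OF \<theta>(1)] that by simp
  define \<psi> where "\<psi> = compose PG_points ?inv \<theta>"
  have \<psi>: "\<psi> \<in> automorphisms (W \<beta>)"
    using compose_automorphisms[OF tau_automorphism \<theta>(1)] by (simp add: \<psi>_def)
  have \<psi>x: "\<psi> x = x" by (simp add: \<psi>_def compose_def \<theta>(2) tau_x)
  have \<psi>l: "\<psi> y = y" if y: "y \<in> lns (Pi_plane \<beta> x)" for y
    using lPG[OF y] induced_h_eq_tau_on_lines[OF ind y] tau_inverse(1)[OF lPG[OF y], of a m k 0]
    by (simp add: \<psi>_def compose_def)
  obtain z where z: "\<psi> (aff 0 0 0) = aff z 0 0" using \<psi> \<psi>x \<psi>l by (rule fixes_Pi_aff)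
  define \<omega> where "\<omega> = compose PG_points (tau 0 0 0 (- z)) \<psi>"
  have \<omega>: "\<omega> \<in> automorphisms (W \<beta>)"
    using compose_automorphisms[OF tau_automorphism \<psi>] by (simp add: \<omega>_def)
  have \<omega>x: "\<omega> x = x" by (simp add: \<omega>_def compose_def \<psi>x tau_x)
  have \<omega>l: "\<omega> y = y" if y: "y \<in> lns (Pi_plane \<beta> x)" for y
  proof -
    obtain w0 w1 w2 where w: "y = ln w0 w1 w2" "w1 \<noteq> 0 \<or> w2 \<noteq> 0" using y by (rule lns_Pi_cases)
    show ?thesis using \<psi>l[OF y] lPG[OF y] unfolding \<omega>_def compose_def w(1) by (simp add: tau_ln[OF w(2)])
  qed
  have \<omega>0: "\<omega> (aff 0 0 0) = aff 0 0 0" by (simp add: \<omega>_def compose_def z tau_aff)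
  have "\<theta> P = tau a m k z P" if P: "P \<in> PG_points" for P
  proof -
    have "tau 0 0 0 (- z) (?inv (\<theta> P)) = P"
      using fixes_Pi_eq_id[OF \<omega> \<omega>x \<omega>l \<omega>0 P] P by (simp add: \<omega>_def \<psi>_def compose_def)
    \<comment> \<open>The transvection only shifts the last parameter, so the two maps merge into
      the inverse of \<open>tau a m k z\<close>.\<close>
    then have "tau (- a) (- m) (m * a - k) (- z) (\<theta> P) = P"
      using tau_tau[OF mem[OF P]] by simp
    then show ?thesis using tau_inverse(2)[OF mem[OF P], of a m k z] by simp
  qed
  moreover have "\<theta> \<in> extensional PG_points" using automorphismsD(1)[OF \<theta>(1)] by simp
  ultimately have "\<theta> = tau a m k z" by (intro extensionalityI[OF _ tau_extensional]) simp_all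
  then show ?thesis by blast
qed


section \<open>The Singer groups\<close>

definition sig :: "'a \<Rightarrow> 'a \<Rightarrow> 'a \<Rightarrow> 'a \<Rightarrow> 'a pg_point \<Rightarrow> 'a pg_point" where
  "sig a m k s = induced_on_payne \<beta> x (tau a m k s)"

lemma sig_extensional: "sig a m k s \<in> extensional (pts (payne_derived \<beta> x))"
  by (simp add: sig_def induced_on_payne_def)

lemma sig_aff: "sig a m k s (aff z b c) = aff (z + a * c + (m * a - k) * b + s) (b + a) (c + m * b + k)"
  by (simp add: sig_def induced_on_payne_def tau_aff)

lemma payne_map_eqI:
  assumes "f \<in> extensional (pts (payne_derived \<beta> x))" "g \<in> extensional (pts (payne_derived \<beta> x))"
    and "\<And>z b c. f (aff z b c) = g (aff z b c)"
  shows "f = g"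
proof (rule extensionalityI[OF assms(1,2)])
  fix P assume "P \<in> pts (payne_derived \<beta> x)"
  then show "f P = g P" by (rule payne_pts_cases) (simp add: assms(3))
qed

lemma sig_eq_iff: "sig a m k s = sig a' m' k' s' \<longleftrightarrow> a = a' \<and> m = m' \<and> k = k' \<and> s = s'"
proof
  assume eq: "sig a m k s = sig a' m' k' s'"
  have e: "aff (z + a * c + (m * a - k) * b + s) (b + a) (c + m * b + k) =
      aff (z + a' * c + (m' * a' - k') * b + s') (b + a') (c + m' * b + k')" for z b c
    unfolding sig_aff[symmetric] eq ..
  show "a = a' \<and> m = m' \<and> k = k' \<and> s = s'"
    using e[of 0 0 0] e[of 0 0 1] by simp
qed simp

lemma compose_sig: "compose (pts (payne_derived \<beta> x)) (sig a' m' k' s') (sig a m k s) =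
    sig (a + a') (m + m') (k + k' + m' * a) (s + s' + a' * k + (m' * a' - k') * a)"
  by (rule payne_map_eqI[OF compose_extensional sig_extensional])
    (simp add: compose_def sig_aff algebra_simps)

lemma sig_zero: "sig 0 0 0 0 = (\<lambda>P\<in>pts (payne_derived \<beta> x). P)"
  by (rule payne_map_eqI[OF sig_extensional]) (simp_all add: sig_aff)

lemma lns_payne: "lns (payne_derived \<beta> x) = {l \<in> lns (W \<beta>). x \<notin> l} \<union>
    {perp (W \<beta>) (perp (W \<beta>) {x, r}) - {x} | r. r \<in> PG_points \<and> \<not> collinear_pts (W \<beta>) x r}"
  by (simp add: payne_derived_def)

text \<open>Both kinds of lines of P(q) are described by \<open>x\<close> and by lines and
  collinearity of W(q), all of which \<open>tau\<close> preserves.\<close>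

lemma sig_automorphism: "sig a m k s \<in> automorphisms (payne_derived \<beta> x)"
proof -
  let ?t = "tau a m k s"
  let ?P = "payne_derived \<beta> x"
  have sub: "pts ?P \<subseteq> PG_points" by (auto simp: pts_payne)
  have W_sub: "l \<subseteq> PG_points" if "l \<in> lns (W \<beta>)" for l using that unfolding lns_W by auto
  have perp_sub: "perp (W \<beta>) X \<subseteq> PG_points" for X by (auto simp: perp_def)
  have l_sub: "l \<subseteq> PG_points" if "l \<in> lns ?P" for l
    using that W_sub perp_sub unfolding lns_payne by fast
  have agree: "sig a m k s P = ?t P" if "P \<in> pts ?P" for P
    using that by (simp add: sig_def induced_on_payne_def)
  have "bij_betw (sig a m k s) (pts ?P) (pts ?P)"
  proof (rule bij_betw_finite_self)
    show "inj_on (sig a m k s) (pts ?P)"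
      using inj_on_subset[OF tau_inj sub] by (simp add: inj_on_def agree)
    show "sig a m k s ` pts ?P \<subseteq> pts ?P"
    proof
      fix P assume "P \<in> sig a m k s ` pts ?P"
      then obtain Q where Q: "P = sig a m k s Q" "Q \<in> pts ?P" by blast
      then obtain z b c where "Q = aff z b c" using payne_pts_cases by blast
      then show "P \<in> pts ?P" using Q by (simp add: sig_aff)
    qed
  qed simp
  then have "sig a m k s \<in> Bij (pts ?P)" by (simp add: Bij_def sig_extensional)
  \<comment> \<open>The line map is the image under \<open>tau\<close> rather than
    \<open>sig\<close>: a line of W(q) not through \<open>x\<close> also contains a point collinear
    with \<open>x\<close>, outside the domain to which \<open>sig\<close> is restricted.\<close>
  moreover have "bij_betw (image ?t) (lns ?P) (lns ?P)"
  proof (rule bij_betw_finite_self)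
    show "inj_on (image ?t) (lns ?P)"
      using l_sub by (auto intro!: inj_onI simp: inj_on_image_eq_iff[OF tau_inj])
    show "image ?t ` lns ?P \<subseteq> lns ?P"
    proof
      fix L assume "L \<in> image ?t ` lns ?P"
      then obtain l where L: "L = ?t ` l" "l \<in> lns ?P" by blast
      from L(2) consider "l \<in> lns (W \<beta>)" "x \<notin> l"
        | r where "r \<in> PG_points" "\<not> collinear_pts (W \<beta>) x r" "l = perp (W \<beta>) (perp (W \<beta>) {x, r}) - {x}"
        unfolding lns_payne by blast
      then show "L \<in> lns ?P"
      proof cases
        case 1
        have "?t ` l \<in> lns (W \<beta>)"
          by (rule automorphism_line_image[OF tau_automorphism 1(1)]) (use W_sub in auto)
        moreover have "?t x \<in> ?t ` l \<longleftrightarrow> x \<in> l"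
          by (rule inj_on_image_mem_iff[OF tau_inj _ W_sub[OF 1(1)]]) simp
        ultimately show ?thesis using 1(2) unfolding L(1) lns_payne by (simp add: tau_x)
      next
        case 2
        have "?t ` l = ?t ` perp (W \<beta>) (perp (W \<beta>) {x, r}) - ?t ` {x}"
          unfolding 2(3) by (rule inj_on_image_set_diff[OF tau_inj]) (use perp_sub in auto)
        also have "?t ` perp (W \<beta>) (perp (W \<beta>) {x, r}) = perp (W \<beta>) (perp (W \<beta>) (?t ` {x, r}))"
          using automorphism_perp[OF tau_automorphism] 2(1) perp_sub by simp
        finally have eq: "L = perp (W \<beta>) (perp (W \<beta>) {x, ?t r}) - {x}"
          unfolding L(1) by (simp add: tau_x)
        have "\<not> collinear_pts (W \<beta>) x (?t r)"
          using automorphism_collinear_iff[OF tau_automorphism, of x r a m k s] 2(1,2) by (simp add: tau_x)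
        then show ?thesis using eq tau_PG[OF 2(1)] unfolding lns_payne by blast
      qed
    qed
  qed simp
  moreover have "inc ?P (sig a m k s p) (?t ` l) \<longleftrightarrow> inc ?P p l" if "p \<in> pts ?P" "l \<in> lns ?P" for p l
    unfolding agree[OF that(1)] 
    using inj_on_image_mem_iff[OF tau_inj subsetD[OF sub that(1)] l_sub[OF that(2)]]
    by (simp add: payne_derived_def)
  ultimately show ?thesis unfolding automorphisms_def by blast
qed

text \<open>\<open>k\<close> is unconstrained because \<open>K\<close> consists of full cosets of
  the center, and \<open>s\<close> because it does not affect the action on \<Pi>(x). That no
  further automorphisms arise is \<open>induced_h_imp_tau\<close>.\<close>

lemma eta_eq:
  assumes K: "K = {Cos a m | a m. (a, m) \<in> S}"
  shows "eta \<beta> x K = {sig a m k s | a m k s. (a, m) \<in> S}"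
proof
  show "eta \<beta> x K \<subseteq> {sig a m k s | a m k s. (a, m) \<in> S}"
  proof
    fix g assume "g \<in> eta \<beta> x K"
    then obtain \<theta> where \<theta>: "g = induced_on_payne \<beta> x \<theta>" "\<theta> \<in> automorphisms (W \<beta>)" "\<theta> x = x"
      "induced_on_Pi \<beta> x \<theta> \<in> \<Union>K" unfolding eta_def by blast
    obtain a m k where amk: "induced_on_Pi \<beta> x \<theta> = h a m k" "(a, m) \<in> S"
      using \<theta>(4) unfolding K Cos_def by blast
    then obtain s where "\<theta> = tau a m k s" using induced_h_imp_tau[OF \<theta>(2,3)] by blast
    then show "g \<in> {sig a m k s | a m k s. (a, m) \<in> S}" using \<theta>(1) amk(2) unfolding sig_def by blast
  qed
  show "{sig a m k s | a m k s. (a, m) \<in> S} \<subseteq> eta \<beta> x K"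
  proof
    fix g assume "g \<in> {sig a m k s | a m k s. (a, m) \<in> S}"
    then obtain a m k s where g: "g = sig a m k s" "(a, m) \<in> S" by blast
    have "induced_on_Pi \<beta> x (tau a m k s) \<in> \<Union>K"
      unfolding induced_tau K using g(2) h_Cos[of a m k a m] by blast
    then show "g \<in> eta \<beta> x K"
      unfolding g(1) sig_def eta_def using tau_automorphism tau_x by blast
  qed
qed

text \<open>A symmetry fixes all lines of \<Pi>(x), hence its points and parallel classes. It
  therefore lies over the identity, which belongs to the preimage of every \<open>K\<close>.\<close>

lemma induced_symmetry:
  assumes "\<theta> \<in> symmetries \<beta> x"
  shows "\<theta> x = x" "induced_on_Pi \<beta> x \<theta> = h 0 0 0"
proof -
  have fixed: "\<theta> y = y" if "y \<in> perp (W \<beta>) {x}" for y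
    using assms that by (simp add: symmetries_def)
  have "x \<in> perp (W \<beta>) {x}" by (simp add: perp_def collinear_x_pp)
  then show "\<theta> x = x" by (rule fixed)
  have "lns (Pi_plane \<beta> x) \<subseteq> perp (W \<beta>) {x}" by (auto simp: Pi_plane_def)
  then have l: "\<theta> y = y" if "y \<in> lns (Pi_plane \<beta> x)" for y
    using fixed that by blast
  have img: "\<theta> ` X = X" if "X \<subseteq> lns (Pi_plane \<beta> x)" for X
    using l that by (force simp: subset_iff)
  have cls: "cls w1 w2 \<subseteq> lns (Pi_plane \<beta> x)" for w1 w2 by (auto simp: cls_def)
  show "induced_on_Pi \<beta> x \<theta> = h 0 0 0"
  proof (rule C_map_eqI[OF _ h_extensional])
    show "induced_on_Pi \<beta> x \<theta> \<in> extensional (pts C)" by (simp add: induced_on_Pi_def)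
  qed (simp_all add: induced_on_Pi_def h_Affine h_Ideal img[OF pt_subset_lns] img[OF cls])
qed

lemma eta_singer:
  assumes "K \<in> BB \<beta> x (Ideal_Point (cls 0 1))"
  shows "eta \<beta> x K \<in> singer_groups_over_symmetries \<beta> x"
proof -
  let ?P = "payne_derived \<beta> x"
  obtain S where K: "K = {Cos a m | a m. (a, m) \<in> S}" and zero: "(0, 0) \<in> S"
    and add: "\<And>a m a' m'. (a, m) \<in> S \<Longrightarrow> (a', m') \<in> S \<Longrightarrow> (a + a', m + m') \<in> S"
    and neg: "\<And>a m. (a, m) \<in> S \<Longrightarrow> (- a, - m) \<in> S"
    and graph: "\<And>a. \<exists>!m. (a, m) \<in> S"
    using assms by (rule BB_cases) blast
  have eta: "eta \<beta> x K = {sig a m k s | a m k s. (a, m) \<in> S}" by (rule eta_eq[OF K])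
  interpret A: group "aut_group ?P" by (rule group_aut_group)
  have mult: "sig a' m' k' s' \<otimes>\<^bsub>aut_group ?P\<^esub> sig a m k s =
      sig (a + a') (m + m') (k + k' + m' * a) (s + s' + a' * k + (m' * a' - k') * a)" for a m k s a' m' k' s'
    using mult_aut_group[OF sig_automorphism sig_automorphism] by (simp add: compose_sig)
  have inv: "inv\<^bsub>aut_group ?P\<^esub> sig a m k s = sig (- a) (- m) (m * a - k) (- s)" for a m k s
    by (rule A.inv_equality) (simp_all add: mult sig_automorphism sig_eq_iff algebra_simps flip: sig_zero)
  have "subgroup (eta \<beta> x K) (aut_group ?P)"
  proof (rule A.subgroupI)
    show "eta \<beta> x K \<subseteq> carrier (aut_group ?P)" using sig_automorphism by (auto simp: eta)
    have "sig 0 0 0 0 \<in> eta \<beta> x K" unfolding eta using zero by blast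
    then show "eta \<beta> x K \<noteq> {}" by blast
  next
    fix g assume "g \<in> eta \<beta> x K"
    then obtain a m k s where "g = sig a m k s" "(a, m) \<in> S" unfolding eta by blast
    then show "inv\<^bsub>aut_group ?P\<^esub> g \<in> eta \<beta> x K" using inv neg unfolding eta by blast
  next
    fix g1 g2 assume "g1 \<in> eta \<beta> x K" "g2 \<in> eta \<beta> x K"
    then obtain a m k s a' m' k' s' where "g1 = sig a' m' k' s'" "(a', m') \<in> S" "g2 = sig a m k s" "(a, m) \<in> S"
      unfolding eta by blast
    then show "g1 \<otimes>\<^bsub>aut_group ?P\<^esub> g2 \<in> eta \<beta> x K" using mult add unfolding eta by blast
  qed
  moreover have "\<exists>!g. g \<in> eta \<beta> x K \<and> g p = r" if p: "p \<in> pts ?P" and r: "r \<in> pts ?P" for p r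
  proof -
    obtain z b c where zbc: "p = aff z b c" using p by (rule payne_pts_cases)
    obtain z' b' c' where zbc': "r = aff z' b' c'" using r by (rule payne_pts_cases)
    \<comment> \<open>Existence of \<open>m\<close> gives transitivity; its uniqueness, used for
      \<open>m2\<close> below, gives sharpness. Both express that \<open>S\<close> is a
      graph.\<close>
    obtain m where m: "(b' - b, m) \<in> S" using graph by blast
    define k where "k = c' - c - m * b"
    define s where "s = z' - z - (b' - b) * c - (m * (b' - b) - k) * b"
    show ?thesis
    proof (rule ex1I[of _ "sig (b' - b) m k s"])
      show "sig (b' - b) m k s \<in> eta \<beta> x K \<and> sig (b' - b) m k s p = r"
        using m unfolding eta zbc zbc' by (auto simp: sig_aff k_def s_def)
    next
      fix g assume g: "g \<in> eta \<beta> x K \<and> g p = r"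
      then obtain a2 m2 k2 s2 where g2: "g = sig a2 m2 k2 s2" "(a2, m2) \<in> S" unfolding eta by blast
      have e: "z' = z + a2 * c + (m2 * a2 - k2) * b + s2" "b' = b + a2" "c' = c + m2 * b + k2"
        using g unfolding g2(1) zbc zbc' sig_aff by simp_all
      have a2: "a2 = b' - b" using e(2) by simp
      have m2: "m2 = m" using graph g2(2) m unfolding a2 by blast
      have k2: "k2 = k" using e(3) by (simp add: k_def m2)
      have "s2 = s" using e(1) by (simp add: s_def a2 m2 k2)
      then show "g = sig (b' - b) m k s" using g2(1) a2 m2 k2 by simp
    qed
  qed
  moreover have "induced_on_payne \<beta> x ` symmetries \<beta> x \<subseteq> eta \<beta> x K"
  proof -
    have "h 0 0 0 \<in> \<Union>K" unfolding K using zero h_Cos[of 0 0 0 0 0] by blast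
    then have "symmetries \<beta> x \<subseteq> {\<theta> \<in> automorphisms (W \<beta>). \<theta> x = x \<and> induced_on_Pi \<beta> x \<theta> \<in> \<Union>K}"
      using induced_symmetry by (auto simp: symmetries_def[of \<beta> x] simp del: Union_iff)
    then show ?thesis unfolding eta_def by (rule image_mono)
  qed
  ultimately show ?thesis by (simp add: singer_groups_over_symmetries_def singer_groups_def)
qed

text \<open>A map \<open>sig a m k s\<close> determines its four parameters, so \<open>S\<close> is
  recovered from the group as the set of pairs \<open>(a, m)\<close> with \<open>sig a m 0 0\<close>
  in it.\<close>

lemma eta_inj: "inj_on (eta \<beta> x) (BB \<beta> x (Ideal_Point (cls 0 1)))"
proof (rule inj_onI)
  fix K K'
  assume K: "K \<in> BB \<beta> x (Ideal_Point (cls 0 1))" and K': "K' \<in> BB \<beta> x (Ideal_Point (cls 0 1))"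
    and eq: "eta \<beta> x K = eta \<beta> x K'"
  obtain S where S: "K = {Cos a m | a m. (a, m) \<in> S}" using K by (rule BB_cases) blast
  obtain S' where S': "K' = {Cos a m | a m. (a, m) \<in> S'}" using K' by (rule BB_cases) blast
  have e: "{sig a m k s | a m k s. (a, m) \<in> S} = {sig a m k s | a m k s. (a, m) \<in> S'}"
    using eq unfolding eta_eq[OF S] eta_eq[OF S'] .
  have mem: "sig a m 0 0 \<in> {sig a m k s | a m k s. (a, m) \<in> U} \<longleftrightarrow> (a, m) \<in> U" for a m U
    by (auto simp: sig_eq_iff)
  have "(a, m) \<in> S \<longleftrightarrow> (a, m) \<in> S'" for a m
    using mem[of a m S] mem[of a m S'] unfolding e by (rule trans[OF sym])
  then show "K = K'" unfolding S S' by simp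
qed

end

section \<open>Symplectic frames adapted to a point and a parallel class\<close>

context symplectic_space
begin

text \<open>The functionals given by independent \<open>u\<close> and \<open>v\<close> are
  independent. With \<open>y\<close> a partner of \<open>v\<close>, the vector \<open>u\<close> is
  cleared against \<open>y\<close>; subtracting a multiple of \<open>y\<close> from a partner
  \<open>z\<close> of the remainder makes the result orthogonal to \<open>v\<close>, while its
  pairing with \<open>u\<close> is that of the remainder with \<open>z\<close>.\<close>

lemma ex_form_one_zero:
  assumes v: "v \<noteq> 0" and u: "u \<notin> proj v"
  shows "\<exists>w. \<beta> u w = 1 \<and> \<beta> v w = 0"
proof -
  obtain y where y: "\<beta> v y = 1" using ex_form_one[OF v] by blast
  have "u - \<beta> u y *s v \<noteq> 0"
  proof
    assume "u - \<beta> u y *s v = 0"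
    then have "u = \<beta> u y *s v" by simp
    then show False using u unfolding proj_def by blast
  qed
  then obtain z where z: "\<beta> (u - \<beta> u y *s v) z = 1" using ex_form_one by blast
  define w where "w = z - \<beta> v z *s y"
  have "\<beta> v w = 0" by (simp add: w_def form_diff form_linear y)
  moreover have "\<beta> u w = 1" using z by (simp add: w_def form_diff form_linear mult.commute)
  ultimately show ?thesis by blast
qed

lemma ex_symplectic_frame:
  assumes e0: "e0 \<noteq> 0" and e2: "e2 \<notin> proj e0" and form: "\<beta> e0 e2 = 0"
  shows "\<exists>e1 e3. symplectic_frame \<beta> e0 e1 e2 e3"
proof -
  have e2': "e2 \<noteq> 0" using e2 unfolding proj_def by (metis rangeI vec.scale_zero_left)
  have "e0 \<notin> proj e2"
  proof
    assume "e0 \<in> proj e2"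
    then obtain t where t: "e0 = t *s e2" unfolding proj_def by blast
    then have "t \<noteq> 0" using e0 by auto
    then have "e2 = (1 / t) *s e0" using t by simp
    then show False using e2 unfolding proj_def by blast
  qed
  from ex_form_one_zero[OF e2' this] obtain e3 where e3: "\<beta> e0 e3 = 1" "\<beta> e2 e3 = 0" by blast
  from ex_form_one_zero[OF e0 e2] obtain f where f: "\<beta> e2 f = 1" "\<beta> e0 f = 0" by blast
  \<comment> \<open>The sign gives \<open>\<beta> e1 e2 = 1\<close>, and the multiple of
    \<open>e0\<close> removes the pairing with \<open>e3\<close>; as \<open>e0\<close> is orthogonal
    to itself and to \<open>e2\<close>, the other values are unaffected.\<close>
  define e1 where "e1 = \<beta> f e3 *s e0 - f"
  have "\<beta> f e2 = -1" using form_skew[of f e2] f by simp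
  then have "\<beta> e0 e1 = 0" "\<beta> e1 e2 = 1" "\<beta> e1 e3 = 0"
    by (simp_all add: e1_def form_diff form_linear form f e3)
  then have "symplectic_frame \<beta> e0 e1 e2 e3"
    using form e3 by unfold_locales simp_all
  then show ?thesis by blast
qed

text \<open>Any line of \<Pi>(x) in the class \<ell> can play the role of \<open>e2\<close>: it is a
  point collinear with \<open>x\<close> and different from it, so the two vectors extend to a frame.
  Hence one coordinate computation covers every choice of \<open>x\<close> and \<ell>.\<close>

lemma ex_frame_Ideal_Point:
  assumes x: "x \<in> pts (W \<beta>)" and l: "l \<in> pts (Pi_completion \<beta> x)" "inc (Pi_completion \<beta> x) l Infinity_Line"
  obtains e0 e1 e2 e3 where "symplectic_frame \<beta> e0 e1 e2 e3" "x = proj e0"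
    "l = Ideal_Point (parallel_class (Pi_plane \<beta> x) (proj e2))"
proof -
  obtain e0 where e0: "x = proj e0" "e0 \<noteq> 0" using x by (auto simp: PG_points_eq)
  obtain c where "l = Ideal_Point c" using l(2) by (cases l) auto
  then obtain y where y: "y \<in> lns (Pi_plane \<beta> x)" "l = Ideal_Point (parallel_class (Pi_plane \<beta> x) y)"
    using l(1) by (auto simp: Ideal_Point_completion)
  have y': "y \<in> PG_points" "collinear_pts (W \<beta>) x y" "y \<noteq> x"
    using y(1) by (auto simp: Pi_plane_def perp_def)
  obtain e2 where e2: "y = proj e2" "e2 \<noteq> 0" using y'(1) by (auto simp: PG_points_eq)
  have "\<beta> e0 e2 = 0" using y'(2) collinear_proj_iff[OF e0(2) e2(2)] unfolding e0(1) e2(1) by simp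
  moreover have "e2 \<notin> proj e0"
  proof
    assume "e2 \<in> proj e0"
    then obtain t where t: "e2 = t *s e0" unfolding proj_def by blast
    then have "t \<noteq> 0" using e2(2) by auto
    then have "proj e0 = proj e2" using proj_eq_iff[OF e0(2)] t by blast
    then show False using y'(3) e0(1) e2(1) by simp
  qed
  ultimately obtain e1 e3 where "symplectic_frame \<beta> e0 e1 e2 e3"
    using ex_symplectic_frame[OF e0(2)] by blast
  then show thesis using that e0(1) y(2) e2(1) by blast
qed

end

theorem theorem4p7:
  fixes \<beta> :: "'a::{field,finite} ^ 4 \<Rightarrow> 'a ^ 4 \<Rightarrow> 'a"
    and x :: "'a pg_point"
    and l :: "('a pg_set, 'a pg_point) cpoint"
    and q :: nat
  assumes "symplectic_form \<beta>"
    and "CARD('a) = q" and "q \<ge> 5"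
    and "x \<in> pts (W \<beta>)"
    and "l \<in> pts (Pi_completion \<beta> x)" and "inc (Pi_completion \<beta> x) l Infinity_Line"
  shows "eta \<beta> x \<in> BB \<beta> x l \<rightarrow> singer_groups_over_symmetries \<beta> x \<and>
         inj_on (eta \<beta> x) (BB \<beta> x l)"
proof -
  interpret space: symplectic_space \<beta> using assms(1) by unfold_locales
  obtain e0 e1 e2 e3 where frame: "symplectic_frame \<beta> e0 e1 e2 e3" and x: "x = proj e0"
    and l: "l = Ideal_Point (parallel_class (Pi_plane \<beta> x) (proj e2))"
    using assms(4-6) by (rule space.ex_frame_Ideal_Point)
  interpret symplectic_frame \<beta> e0 e1 e2 e3 by (rule frame)
  have e0: "x = pp 1 0 0 0" by (simp add: x proj_e0)
  have "proj e2 = ln 0 0 1" by (simp add: ln_def pp_def vc_def)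
  then have "l = Ideal_Point (cls 0 1)" unfolding l e0 cls_def by simp
  then show ?thesis
    unfolding e0 using eta_singer eta_inj by blast
qed

end
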